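(* (1) There exists a unique linear operator $\tilde D:\Lambda\to\Lambda$ such that $D_{n+1,n}f_n=\frac1{n+1}(\tilde Df)_{n+1}$ for all $n=0,1,\dots$ and all $f\in\Lambda$; in the basis $\{FS_\mu\}$ it is given by $\tilde D\,FS_\mu=(p_1-|\mu|)FS_\mu$, $\mu\in\mathbb Y$. (2) There exists a unique linear operator $\tilde U:\Lambda\to\Lambda$ (depending on $z,z'$) such that $U_{n,n+1}f_{n+1}=\frac1{zz'+n}(\tilde Uf)_n$ for all $n=0,1,\dots$ and all $f\in\Lambda$; in the basis $\{FS_\mu\}$ it is given by $$\tilde U\,FS_\mu=\sum_{\mu_\bullet\nearrow\mu}(z)_{\mu/\mu_\bullet}(z')_{\mu/\mu_\bullet}FS_{\mu_\bullet}+(p_1+zz'+|\mu|)FS_\mu,\qquad\mu\in\mathbb Y.$$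
   Context: $\mathbb Y$ is the set of all Young diagrams (including the empty one $\varnothing$), $\mathbb Y_n$ those with $n$ boxes, $|\lambda|$ the number of boxes. $\mu\nearrow\lambda$ (equivalently $\lambda\searrow\mu$) means $\mu\subset\lambda$ and $|\lambda|=|\mu|+1$. For a skew diagram $\theta$ and $z\in\mathbb C$, $(z)_\theta=\prod_{(i,j)\in\theta}(z+j-i)$ (product over boxes, $(i,j)$ = row $i$, column $j$). $\dim\lambda$ is the number of standard Young tableaux of shape $\lambda$ ($\dim\varnothing=1$), and $\dim(\mu,\lambda)$ is the number of chains $\mu\nearrow\cdots\nearrow\lambda$ (zero unless $\mu\subseteq\lambda$; $1$ if $\mu=\lambda$). Modified Frobenius coordinates: $\lambda=(a_1,\dots,a_d\mid b_1,\dots,b_d)$ with $d$ the number of diagonal boxes, $a_i=\lambda_i-i+\frac12$, $b_i=\lambda'_i-i+\frac12$ ($\lambda_i$, $\lambda'_i$ row and column lengths). $(z,z')$ is fixed in the principal series ($z\notin\mathbb R$, $z'=\bar z$) or complementary series ($z,z'\in(N,N+1)$ for some $N\in\mathbb Z$); then $zz'>0$. Down transition: $p^\downarrow(\nu,\lambda)=\dim\lambda/\dim\nu$ if $\lambda\nearrow\nu$, else $0$. Up transition: for $\lambda\in\mathbb Y_n$, $p^\uparrow(\lambda,\nu)=\frac{(z)_{\nu/\lambda}(z')_{\nu/\lambda}}{zz'+n}\frac{\dim\nu}{(n+1)\dim\lambda}$ if $\nu\searrow\lambda$, else 0. $C(\mathbb Y_n)$ is the space of real functions on $\mathbb Y_n$;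 $D_{n+1,n}:C(\mathbb Y_n)\to C(\mathbb Y_{n+1})$, $(D_{n+1,n}f)(\nu)=\sum_{\lambda\in\mathbb Y_n}p^\downarrow(\nu,\lambda)f(\lambda)$; $U_{n,n+1}:C(\mathbb Y_{n+1})\to C(\mathbb Y_n)$, $(U_{n,n+1}g)(\lambda)=\sum_{\nu\in\mathbb Y_{n+1}}p^\uparrow(\lambda,\nu)g(\nu)$. $\Lambda=\mathbb R[p_1,p_2,\dots]$ is the algebra of symmetric functions (power sums $p_k$, Schur functions $s_\mu$), embedded injectively into the algebra of real functions on $\mathbb Y$ by $p_k(\lambda)=\sum_{i=1}^da_i^k+(-1)^{k-1}\sum_{i=1}^db_i^k$ (so $p_1(\lambda)=|\lambda|$). For $f\in\Lambda$, $f_n$ is the restriction of the function $f(\cdot)$ to $\mathbb Y_n$. The Frobenius–Schur functions $FS_\mu\in\Lambda$ ($\mu\in\mathbb Y$) are the elements with $FS_\mu(\lambda)=n^{\downarrow m}\frac{\dim(\mu,\lambda)}{\dim\lambda}$ for all $\lambda$, where $n=|\lambda|$, $m=|\mu|$, $n^{\downarrow m}=n(n-1)\cdots(n-m+1)$; $FS_\mu-s_\mu$ has degree $<|\mu|$, and $\{FS_\mu\}$ is a basis of $\Lambda$. *)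

theory Defs
  imports Complex_Main
begin

definition young :: "nat list \<Rightarrow> bool" where
  "young l \<longleftrightarrow> sorted_wrt (\<ge>) l \<and> 0 \<notin> set l"

definition Ydiag :: "nat \<Rightarrow> nat list set" where
  "Ydiag n = {l. young l \<and> sum_list l = n}"

definition boxes :: "nat list \<Rightarrow> (nat \<times> nat) set" where
  "boxes l = {(i, j). 1 \<le> i \<and> i \<le> length l \<and> 1 \<le> j \<and> j \<le> l ! (i - 1)}"

definition covers :: "nat list \<Rightarrow> nat list \<Rightarrow> bool" (infix "\<nearrow>" 50) where
  "mu \<nearrow> lam \<longleftrightarrow> young mu \<and> young lam \<and> boxes mu \<subseteq> boxes lam \<and>
     sum_list lam = sum_list mu + 1"

definition skew_poch :: "complex \<Rightarrow> nat list \<Rightarrow> nat list \<Rightarrow> complex" where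
  "skew_poch z lam mu = (\<Prod>(i, j)\<in>boxes lam - boxes mu. z + of_int (int j - int i))"

definition chains :: "nat list \<Rightarrow> nat list \<Rightarrow> nat list list set" where
  "chains mu lam = {xs. xs \<noteq> [] \<and> hd xs = mu \<and> last xs = lam \<and> (\<forall>x\<in>set xs. young x) \<and>
      (\<forall>i. Suc i < length xs \<longrightarrow> xs ! i \<nearrow> xs ! Suc i)}"

definition dimr :: "nat list \<Rightarrow> nat list \<Rightarrow> nat" where
  "dimr mu lam = card (chains mu lam)"

definition dimY :: "nat list \<Rightarrow> nat" where
  "dimY lam = dimr [] lam"

definition conj_len :: "nat list \<Rightarrow> nat \<Rightarrow> nat" where
  "conj_len l j = length (filter (\<lambda>x. j \<le> x) l)"

definition diag_len :: "nat list \<Rightarrow> nat" where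
  "diag_len l = card {i. 1 \<le> i \<and> i \<le> length l \<and> i \<le> l ! (i - 1)}"

definition frob_a :: "nat list \<Rightarrow> nat \<Rightarrow> real" where
  "frob_a l i = real (l ! (i - 1)) - real i + 1/2"

definition frob_b :: "nat list \<Rightarrow> nat \<Rightarrow> real" where
  "frob_b l i = real (conj_len l i) - real i + 1/2"

definition psum :: "nat \<Rightarrow> nat list \<Rightarrow> real" where
  "psum k l = (\<Sum>i=1..diag_len l. frob_a l i ^ k + (-1) ^ (k - 1) * frob_b l i ^ k)"

section \<open>The algebra Lambda, realised as its (injective) image in functions on Y\<close>

inductive_set Lam :: "(nat list \<Rightarrow> real) set" where
  const: "(\<lambda>l. if young l then c else 0) \<in> Lam"
| gen: "1 \<le> k \<Longrightarrow> (\<lambda>l. if young l then psum k l else 0) \<in> Lam"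
| add: "f \<in> Lam \<Longrightarrow> g \<in> Lam \<Longrightarrow> (\<lambda>l. f l + g l) \<in> Lam"
| mult: "f \<in> Lam \<Longrightarrow> g \<in> Lam \<Longrightarrow> (\<lambda>l. f l * g l) \<in> Lam"

definition lin_op_Lam :: "((nat list \<Rightarrow> real) \<Rightarrow> (nat list \<Rightarrow> real)) \<Rightarrow> bool" where
  "lin_op_Lam T \<longleftrightarrow> (\<forall>f\<in>Lam. T f \<in> Lam) \<and>
     (\<forall>f\<in>Lam. \<forall>g\<in>Lam. T (\<lambda>l. f l + g l) = (\<lambda>l. T f l + T g l)) \<and>
     (\<forall>f\<in>Lam. \<forall>c::real. T (\<lambda>l. c * f l) = (\<lambda>l. c * T f l))"

definition falling :: "nat \<Rightarrow> nat \<Rightarrow> real" where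
  "falling n m = (\<Prod>i<m. real n - real i)"

definition FS :: "nat list \<Rightarrow> nat list \<Rightarrow> real" where
  "FS mu = (\<lambda>lam. if young lam then
      falling (sum_list lam) (sum_list mu) * real (dimr mu lam) / real (dimY lam) else 0)"

definition pdown :: "nat list \<Rightarrow> nat list \<Rightarrow> real" where
  "pdown nu lam = (if lam \<nearrow> nu then real (dimY lam) / real (dimY nu) else 0)"

definition pup :: "complex \<Rightarrow> complex \<Rightarrow> nat list \<Rightarrow> nat list \<Rightarrow> real" where
  "pup z z' lam nu = (if lam \<nearrow> nu then
      Re (skew_poch z nu lam * skew_poch z' nu lam) / (Re (z * z') + real (sum_list lam))
      * real (dimY nu) / ((real (sum_list lam) + 1) * real (dimY lam))
    else 0)"

definition Dop :: "nat \<Rightarrow> (nat list \<Rightarrow> real) \<Rightarrow> nat list \<Rightarrow> real" where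
  "Dop n f nu = (\<Sum>lam\<in>Ydiag n. pdown nu lam * f lam)"

definition Uop :: "complex \<Rightarrow> complex \<Rightarrow> nat \<Rightarrow> (nat list \<Rightarrow> real) \<Rightarrow> nat list \<Rightarrow> real" where
  "Uop z z' n g lam = (\<Sum>nu\<in>Ydiag (Suc n). pup z z' lam nu * g nu)"

text \<open>Principal or complementary series.\<close>
definition admissible :: "complex \<Rightarrow> complex \<Rightarrow> bool" where
  "admissible z z' \<longleftrightarrow> (Im z \<noteq> 0 \<and> z' = cnj z) \<or>
     (\<exists>N::int. Im z = 0 \<and> Im z' = 0 \<and> of_int N < Re z \<and> Re z < of_int N + 1 \<and>
        of_int N < Re z' \<and> Re z' < of_int N + 1)"

end

theory Submission
  imports Defs "HOL-Computational_Algebra.Computational_Algebra"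
begin

text \<open>Both operators are forced off the empty diagram; what has to be shown is that they preserve
  \<open>Lam\<close>. Adding or removing a box of content \<open>c\<close> changes an element of \<open>Lam\<close> by a polynomial
  in \<open>c\<close> with coefficients in \<open>Lam\<close>, so it suffices that the moments of the contents under the
  transition weights \<open>n dim(rho) / dim(lam)\<close> and \<open>dim(nu) / ((n + 1) dim(lam))\<close> lie in
  \<open>Lam\<close>. These weights are the residues of a rational function and of its inverse, whose zeros and
  poles are the contents of the removable and the addable boxes. The logarithmic derivative of that function
  has power sums of contents as coefficients, and Newton's recursion then puts the moments into
  \<open>Lam\<close>.

  The formulas on the Frobenius-Schur functions reduce to an identity for numbers of chains, proved by
  interchanging the addition and the removal of a box.\<close>

text \<open>No hook formula enters. That the residues at the removable corners are
  \<open>n dim(rho) / dim(lam)\<close> is shown by induction on the size: the product of the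
  residues for two successive removals does not depend on their order, which puts them in the same
  ratio as the dimensions, and their total is \<open>n\<close>, which fixes the factor. The residues
  at the addable corners are then reciprocals of residues of the enlarged diagram. The inverse
  function grows linearly at infinity, so the down moments begin only in the coefficient of order
  two of its expansion; the coefficient of order one is an unknown constant, which vanishes because
  the contents of the addable and of the removable boxes have equal sums. The parameters enter only
  through \<open>(z + c)(z' + c)\<close>, a monic quadratic in the content \<open>c\<close>. Its
  first difference has slope \<open>2\<close>, so adding and removing a box in the two orders differ
  by \<open>zz' + 2n\<close>; summing these differences along the induction produces the factor
  \<open>p_1 + zz' + |mu|\<close>.\<close>

section \<open>Diagrams as weakly decreasing row functions\<close>

definition row :: "nat list \<Rightarrow> nat \<Rightarrow> nat" where
  "row l i = (if i < length l then l ! i else 0)"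

text \<open>Inverse of \<open>row\<close> on weakly decreasing functions that reach zero. With zero
  padding, adding or removing a box is an update of a function at one point, even when a row is
  opened or emptied.\<close>

definition of_rows :: "(nat \<Rightarrow> nat) \<Rightarrow> nat list" where
  "of_rows r = map r [0..<(LEAST n. r n = 0)]"

lemma row_length [simp]: "length l \<le> i \<Longrightarrow> row l i = 0"
  by (simp add: row_def)

lemma row_Nil [simp]: "row [] i = 0"
  by (simp add: row_def)

lemma antimono_row: "young l \<Longrightarrow> antimono (row l)"
  unfolding young_def antimono_def row_def sorted_wrt_iff_nth_less
  by (auto simp: le_less)

lemma row_mono: "young l \<Longrightarrow> i \<le> j \<Longrightarrow> row l j \<le> row l i"
  using antimono_row by (auto simp: antimono_def)

lemma row_eq_0_iff: "young l \<Longrightarrow> row l i = 0 \<longleftrightarrow> length l \<le> i"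
  by (cases "i < length l") (auto simp: young_def row_def in_set_conv_nth)

lemma young_Nil [simp]: "young []"
  by (simp add: young_def)

lemma row_inject:
  assumes "young l" "young m" "row l = row m"
  shows "l = m"
proof (rule nth_equalityI)
  show len: "length l = length m"
    using assms row_eq_0_iff by (metis dual_order.antisym order_refl)
  fix i assume "i < length l"
  then show "l ! i = m ! i"
    using fun_cong[OF assms(3), of i] len by (simp add: row_def)
qed

lemma of_rows:
  assumes "antimono r" "r N = 0"
  shows "young (of_rows r)" "row (of_rows r) = r"
proof -
  define L where "L = (LEAST n. r n = 0)"
  have L0: "r L = 0" unfolding L_def using assms(2) by (rule LeastI)
  have Lpos: "0 < r i" if "i < L" for i
    using not_less_Least[of i "\<lambda>n. r n = 0"] that unfolding L_def by auto
  have anti: "i \<le> j \<Longrightarrow> r j \<le> r i" for i j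
    using assms(1) by (auto simp: antimono_def)
  show "young (of_rows r)"
    unfolding young_def of_rows_def L_def[symmetric]
    using anti by (auto simp: sorted_wrt_iff_nth_less) (metis Lpos less_irrefl)
  show "row (of_rows r) = r"
  proof
    fix i
    show "row (of_rows r) i = r i"
    proof (cases "i < L")
      case True then show ?thesis by (simp add: row_def of_rows_def L_def[symmetric])
    next
      case False
      then have "r i = 0" using anti[of L i] L0 by simp
      with False show ?thesis by (simp add: row_def of_rows_def L_def[symmetric])
    qed
  qed
qed

lemma sum_list_row: "length l \<le> N \<Longrightarrow> sum_list l = (\<Sum>i<N. row l i)"
proof -
  assume "length l \<le> N"
  then have "(\<Sum>i<N. row l i) = (\<Sum>i<length l. row l i)"
    by (intro sum.mono_neutral_right) auto
  then show ?thesis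
    by (simp add: sum_list_sum_nth row_def atLeast0LessThan)
qed

lemma boxes_row: "boxes l = {(i, j). 1 \<le> i \<and> 1 \<le> j \<and> j \<le> row l (i - 1)}"
  unfolding boxes_def row_def by (auto split: if_splits)

lemma boxes_subset_iff: "boxes l \<subseteq> boxes m \<longleftrightarrow> (\<forall>i. row l i \<le> row m i)"
proof
  assume *: "boxes l \<subseteq> boxes m"
  show "\<forall>i. row l i \<le> row m i"
  proof
    fix i
    show "row l i \<le> row m i"
    proof (cases "row l i = 0")
      case False
      then have "(Suc i, row l i) \<in> boxes l" by (simp add: boxes_row)
      with * have "(Suc i, row l i) \<in> boxes m" by blast
      then show ?thesis by (simp add: boxes_row)
    qed simp
  qed
next
  assume "\<forall>i. row l i \<le> row m i"
  then show "boxes l \<subseteq> boxes m"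
    by (auto simp: boxes_row intro: le_trans)
qed

text \<open>Over a common range of rows the differences \<open>row lam i - row mu i\<close> are
  natural numbers with sum \<open>1\<close>, so exactly one of them is \<open>1\<close>.\<close>

lemma covers_iff:
  "mu \<nearrow> lam \<longleftrightarrow> young mu \<and> young lam \<and> (\<exists>i. row lam = (row mu)(i := Suc (row mu i)))"
proof
  assume *: "mu \<nearrow> lam"
  define N where "N = max (length mu) (length lam)"
  have le: "row mu i \<le> row lam i" for i
    using * unfolding covers_def boxes_subset_iff by blast
  have "sum_list lam = sum_list mu + 1" using * by (simp add: covers_def)
  then have "(\<Sum>i<N. row lam i) = (\<Sum>i<N. row mu i) + 1"
    using sum_list_row[of lam N] sum_list_row[of mu N] by (simp add: N_def)
  then have s1: "(\<Sum>i<N. row lam i - row mu i) = 1"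
    using le by (simp add: sum_subtractf_nat)
  then obtain i where i: "i < N" "row lam i - row mu i = 1"
      "\<And>j. j < N \<Longrightarrow> j \<noteq> i \<Longrightarrow> row lam j - row mu j = 0"
    using sum_eq_1_iff[of "{..<N}" "\<lambda>i. row lam i - row mu i"] by (auto simp del: diff_is_0_eq)
  have "row lam = (row mu)(i := Suc (row mu i))"
  proof
    fix j show "row lam j = ((row mu)(i := Suc (row mu i))) j"
    proof (cases "j < N \<and> j \<noteq> i")
      case True
      then show ?thesis using i(3)[of j] le[of j] by simp
    next
      case False
      then show ?thesis using i(1,2) by (auto simp: N_def not_less)
    qed
  qed
  then show "young mu \<and> young lam \<and> (\<exists>i. row lam = (row mu)(i := Suc (row mu i)))"
    using * by (auto simp: covers_def)
next
  assume "young mu \<and> young lam \<and> (\<exists>i. row lam = (row mu)(i := Suc (row mu i)))"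
  then obtain i where y: "young mu" "young lam" and r: "row lam = (row mu)(i := Suc (row mu i))"
    by blast
  define N where "N = Suc (i + length mu + length lam)"
  have "sum_list lam = (\<Sum>j<N. ((row mu)(i := Suc (row mu i))) j)"
    using sum_list_row[of lam N] r by (simp add: N_def)
  also have "\<dots> = (\<Sum>j<N. row mu j + (if j = i then 1 else 0))"
    by (intro sum.cong) auto
  also have "\<dots> = sum_list mu + 1"
    using sum_list_row[of mu N] by (simp add: sum.distrib N_def)
  finally show "mu \<nearrow> lam"
    using y r by (auto simp: covers_def boxes_subset_iff)
qed

section \<open>Adding and removing a box, indexed by its row\<close>

definition up :: "nat list \<Rightarrow> nat \<Rightarrow> nat list" where
  "up l i = of_rows ((row l)(i := Suc (row l i)))"

definition dn :: "nat list \<Rightarrow> nat \<Rightarrow> nat list" where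
  "dn l i = of_rows ((row l)(i := row l i - 1))"

text \<open>Row \<open>0\<close> is listed apart because \<open>i - 1\<close> is truncated there:
  the top row always accepts a box.\<close>

definition upI :: "nat list \<Rightarrow> nat set" where
  "upI l = {i. i = 0 \<or> row l i < row l (i - 1)}"

definition dnI :: "nat list \<Rightarrow> nat set" where
  "dnI l = {i. row l (Suc i) < row l i}"

lemma
  assumes "young l" "i \<in> upI l"
  shows young_up: "young (up l i)" and row_up: "row (up l i) = (row l)(i := Suc (row l i))"
proof -
  let ?r = "(row l)(i := Suc (row l i))"
  have "antimono ?r"
    unfolding antimono_iff_le_Suc
  proof
    fix k show "?r (Suc k) \<le> ?r k"
      using assms row_mono[OF assms(1), of k "Suc k"] by (auto simp: upI_def)
  qed
  moreover have "?r (Suc i + length l) = 0" by simp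
  ultimately show "young (up l i)" "row (up l i) = ?r"
    unfolding up_def using of_rows by blast+
qed

lemma
  assumes "young l" "i \<in> dnI l"
  shows young_dn: "young (dn l i)" and row_dn: "row (dn l i) = (row l)(i := row l i - 1)"
proof -
  let ?r = "(row l)(i := row l i - 1)"
  have "antimono ?r"
    unfolding antimono_iff_le_Suc
  proof
    fix k show "?r (Suc k) \<le> ?r k"
      using assms row_mono[OF assms(1), of k "Suc k"] by (auto simp: dnI_def)
  qed
  moreover have "?r (Suc i + length l) = 0" by simp
  ultimately show "young (dn l i)" "row (dn l i) = ?r"
    unfolding dn_def using of_rows by blast+
qed

lemma upI_bound: "i \<in> upI l \<Longrightarrow> i \<le> length l"
  by (rule ccontr) (auto simp: upI_def)

lemma dnI_bound: "i \<in> dnI l \<Longrightarrow> i < length l"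
  by (rule ccontr) (auto simp: dnI_def)

lemma finite_upI [simp]: "finite (upI l)"
  by (rule finite_subset[of _ "{..length l}"]) (auto dest: upI_bound)

lemma finite_dnI [simp]: "finite (dnI l)"
  by (rule finite_subset[of _ "{..<length l}"]) (auto dest: dnI_bound)

lemma covers_up: "young l \<Longrightarrow> i \<in> upI l \<Longrightarrow> l \<nearrow> up l i"
  unfolding covers_iff by (auto simp: young_up row_up)

lemma covers_dn: "young l \<Longrightarrow> i \<in> dnI l \<Longrightarrow> dn l i \<nearrow> l"
  unfolding covers_iff by (auto simp: young_dn row_dn dnI_def intro!: exI[of _ i])

lemma inj_up: "young l \<Longrightarrow> inj_on (up l) (upI l)"
proof (rule inj_onI)
  fix i j assume "young l" "i \<in> upI l" "j \<in> upI l" "up l i = up l j"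
  then have "(row l)(i := Suc (row l i)) = (row l)(j := Suc (row l j))"
    by (metis row_up)
  then show "i = j"
    by (metis fun_upd_other fun_upd_same n_not_Suc_n)
qed

lemma inj_dn: "young l \<Longrightarrow> inj_on (dn l) (dnI l)"
proof (rule inj_onI)
  fix i j assume a: "young l" "i \<in> dnI l" "j \<in> dnI l" "dn l i = dn l j"
  then have "(row l)(i := row l i - 1) = (row l)(j := row l j - 1)"
    by (metis row_dn)
  \<comment> \<open>For \<open>i \<noteq> j\<close> this reads \<open>row l i - 1 = row l i\<close>,
    impossible because a removable row is nonempty.\<close>
  then have "(row l i - 1) = ((row l)(j := row l j - 1)) i"
    by (metis fun_upd_same)
  then show "i = j"
    using a(2) by (auto simp: dnI_def split: if_splits)
qed

lemma coversE_up:
  assumes "l \<nearrow> nu"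
  obtains i where "i \<in> upI l" "nu = up l i"
proof -
  obtain i where y: "young l" "young nu" and r: "row nu = (row l)(i := Suc (row l i))"
    using assms unfolding covers_iff by blast
  have "i \<in> upI l"
  proof (cases i)
    case (Suc k)
    have "row nu (Suc k) \<le> row nu k" using y by (simp add: row_mono)
    then show ?thesis using r Suc by (simp add: upI_def)
  qed (simp add: upI_def)
  moreover have "nu = up l i"
    using row_inject[OF y(2) young_up[OF y(1) calculation]] row_up[OF y(1) calculation] r by simp
  ultimately show ?thesis using that by blast
qed

lemma coversE_dn:
  assumes "mu \<nearrow> l"
  obtains i where "i \<in> dnI l" "mu = dn l i"
proof -
  obtain i where y: "young mu" "young l" and r: "row l = (row mu)(i := Suc (row mu i))"
    using assms unfolding covers_iff by blast
  have i: "i \<in> dnI l"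
    using r row_mono[OF y(1), of i "Suc i"] by (simp add: dnI_def)
  moreover have "mu = dn l i"
    using row_inject[OF y(1) young_dn[OF y(2) i]] row_dn[OF y(2) i] r by simp
  ultimately show ?thesis using that by blast
qed

lemma covers_up_eq: "young l \<Longrightarrow> {nu. l \<nearrow> nu} = up l ` upI l"
  by (auto elim: coversE_up intro: covers_up)

lemma covers_dn_eq: "young l \<Longrightarrow> {mu. mu \<nearrow> l} = dn l ` dnI l"
  by (auto elim: coversE_dn intro: covers_dn)

lemma sum_covers_up: "young l \<Longrightarrow> (\<Sum>nu | l \<nearrow> nu. f nu) = (\<Sum>i\<in>upI l. f (up l i))"
  by (simp add: covers_up_eq sum.reindex[OF inj_up])

lemma sum_covers_dn: "young l \<Longrightarrow> (\<Sum>mu | mu \<nearrow> l. f mu) = (\<Sum>i\<in>dnI l. f (dn l i))"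
  by (simp add: covers_dn_eq sum.reindex[OF inj_dn])

lemma covers_youngD: "mu \<nearrow> lam \<Longrightarrow> young mu" "mu \<nearrow> lam \<Longrightarrow> young lam"
  by (auto simp: covers_def)

lemma covers_sum_list: "mu \<nearrow> lam \<Longrightarrow> sum_list lam = Suc (sum_list mu)"
  by (auto simp: covers_def)

lemma sum_list_up: "young l \<Longrightarrow> i \<in> upI l \<Longrightarrow> sum_list (up l i) = Suc (sum_list l)"
  using covers_up covers_sum_list by blast

lemma sum_list_dn: "young l \<Longrightarrow> i \<in> dnI l \<Longrightarrow> Suc (sum_list (dn l i)) = sum_list l"
  using covers_dn covers_sum_list by metis

lemma up_in_dnI: "young l \<Longrightarrow> i \<in> upI l \<Longrightarrow> i \<in> dnI (up l i) \<and> dn (up l i) i = l"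
proof -
  assume a: "young l" "i \<in> upI l"
  have d: "i \<in> dnI (up l i)"
    using a row_mono[OF a(1), of i "Suc i"] by (simp add: dnI_def row_up)
  moreover have "dn (up l i) i = l"
    by (rule row_inject) (use a d in \<open>auto simp: row_dn row_up young_up young_dn\<close>)
  ultimately show ?thesis by blast
qed

lemma dn_in_upI: "young l \<Longrightarrow> i \<in> dnI l \<Longrightarrow> i \<in> upI (dn l i) \<and> up (dn l i) i = l"
proof -
  assume a: "young l" "i \<in> dnI l"
  have d: "i \<in> upI (dn l i)"
    using a row_mono[OF a(1), of "i-1" i] by (auto simp: upI_def row_dn dnI_def)
  moreover have "up (dn l i) i = l"
    by (rule row_inject) (use a d in \<open>auto simp: row_dn row_up young_up young_dn dnI_def\<close>)
  ultimately show ?thesis by blast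
qed

lemma finite_Ydiag: "finite (Ydiag n)"
proof (rule finite_subset)
  show "finite {xs. set xs \<subseteq> {..n} \<and> length xs \<le> n}"
    by (rule finite_lists_length_le) simp
  show "Ydiag n \<subseteq> {xs. set xs \<subseteq> {..n} \<and> length xs \<le> n}"
  proof
    fix xs assume "xs \<in> Ydiag n"
    then have *: "0 \<notin> set xs" "sum_list xs = n" by (auto simp: Ydiag_def young_def)
    have "length xs \<le> sum_list xs"
      using *(1) by (induction xs) auto
    moreover have "x \<in> set xs \<Longrightarrow> x \<le> sum_list xs" for x
      by (simp add: member_le_sum_list)
    ultimately show "xs \<in> {xs. set xs \<subseteq> {..n} \<and> length xs \<le> n}" using * by auto
  qed
qed

section \<open>Dimensions\<close>

lemma chains_snocD:
  assumes "xs @ [x] \<in> chains mu lam" "xs \<noteq> []"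
  shows "x = lam" "xs \<in> chains mu (last xs)" "last xs \<nearrow> lam"
proof -
  have step: "(xs @ [x]) ! i \<nearrow> (xs @ [x]) ! Suc i" if "Suc i < length (xs @ [x])" for i
    using assms that unfolding chains_def by blast
  show "x = lam" using assms by (simp add: chains_def)
  have "xs ! i \<nearrow> xs ! Suc i" if "Suc i < length xs" for i
    using step[of i] that by (simp add: nth_append)
  then show "xs \<in> chains mu (last xs)"
    using assms unfolding chains_def by auto
  show "last xs \<nearrow> lam"
    using step[of "length xs - 1"] assms(2) \<open>x = lam\<close> by (simp add: nth_append last_conv_nth)
qed

text \<open>Each step adds one box, so the sizes of the two ends fix the length of a chain. This
  decides all cases where \<open>lam\<close> is not larger than \<open>mu\<close>.\<close>

lemma chains_sum_list: "xs \<in> chains mu lam \<Longrightarrow> sum_list mu + length xs = Suc (sum_list lam)"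
proof (induction xs arbitrary: lam rule: rev_induct)
  case Nil then show ?case by (simp add: chains_def)
next
  case (snoc x xs)
  show ?case
  proof (cases "xs = []")
    case True with snoc.prems show ?thesis by (auto simp: chains_def)
  next
    case False
    note * = chains_snocD[OF snoc.prems False]
    show ?thesis using snoc.IH[OF *(2)] covers_sum_list[OF *(3)] by simp
  qed
qed

lemma dimr_self: "young mu \<Longrightarrow> dimr mu mu = 1"
proof -
  assume "young mu"
  have "chains mu mu = {[mu]}"
  proof
    show "chains mu mu \<subseteq> {[mu]}"
    proof
      fix xs assume xs: "xs \<in> chains mu mu"
      then have "length xs = 1" using chains_sum_list by fastforce
      then show "xs \<in> {[mu]}" using xs by (auto simp: length_Suc_conv chains_def)
    qed
  qed (use \<open>young mu\<close> in \<open>auto simp: chains_def\<close>)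
  then show ?thesis by (simp add: dimr_def)
qed

lemma chains_snoc:
  assumes "mu \<noteq> lam"
  shows "chains mu lam = (\<Union>rho\<in>{rho. rho \<nearrow> lam}. (\<lambda>xs. xs @ [lam]) ` chains mu rho)"
proof (intro equalityI subsetI)
  fix xs assume xs: "xs \<in> chains mu lam"
  then have "xs = butlast xs @ [lam]"
    using append_butlast_last_id[of xs] by (simp add: chains_def)
  then obtain ys where ys: "xs = ys @ [lam]" by blast
  have ne: "ys \<noteq> []" using assms xs ys by (auto simp: chains_def)
  show "xs \<in> (\<Union>rho\<in>{rho. rho \<nearrow> lam}. (\<lambda>xs. xs @ [lam]) ` chains mu rho)"
    using chains_snocD(2,3)[OF xs[unfolded ys] ne] ys by blast
next
  fix xs assume "xs \<in> (\<Union>rho\<in>{rho. rho \<nearrow> lam}. (\<lambda>xs. xs @ [lam]) ` chains mu rho)"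
  then obtain rho ys where r: "rho \<nearrow> lam" and ys: "ys \<in> chains mu rho" "xs = ys @ [lam]" by blast
  have l: "last ys = rho" "ys \<noteq> []" using ys by (auto simp: chains_def)
  have "(ys @ [lam]) ! i \<nearrow> (ys @ [lam]) ! Suc i" if "Suc i < length (ys @ [lam])" for i
  proof (cases "Suc i < length ys")
    case True then show ?thesis using ys by (auto simp: chains_def nth_append)
  next
    case False
    then have i: "i = length ys - 1" "Suc i = length ys" using that by auto
    have "(ys @ [lam]) ! i = rho" using l i by (simp add: nth_append last_conv_nth)
    moreover have "(ys @ [lam]) ! Suc i = lam" unfolding i(2) by simp
    ultimately show ?thesis using r by simp
  qed
  then show "xs \<in> chains mu lam"
    using ys r by (auto simp: chains_def covers_youngD)
qed

lemma chains_not_young: "\<not> young lam \<Longrightarrow> chains mu lam = {}"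
  unfolding chains_def by (auto dest: last_in_set)

lemma finite_chains: "finite (chains mu lam)"
proof (induction "sum_list lam" arbitrary: lam rule: less_induct)
  case less
  show ?case
  proof (cases "young lam \<and> mu \<noteq> lam")
    case True
    have "finite {rho. rho \<nearrow> lam}" using True by (simp add: covers_dn_eq)
    moreover have "finite (chains mu rho)" if "rho \<nearrow> lam" for rho
      using less[of rho] covers_sum_list[OF that] by simp
    ultimately show ?thesis using True by (auto simp: chains_snoc)
  next
    case False
    then consider "\<not> young lam" | "young lam" "mu = lam" by blast
    then show ?thesis
    proof cases
      case 2
      \<comment> \<open>A nonzero cardinality already forces finiteness, which settles the case
        excluded by \<open>chains_snoc\<close>.\<close>
      then have "card (chains mu lam) = 1" using dimr_self by (simp add: dimr_def)
      then show ?thesis by (intro card_ge_0_finite) simp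
    qed (simp add: chains_not_young)
  qed
qed

text \<open>Chains are sorted by their last but one diagram. The one-element chain has none, so the
  rule fails for \<open>mu = lam\<close>; later uses recover that case from a vanishing
  factor.\<close>

lemma dimr_rec:
  assumes "young lam" "mu \<noteq> lam"
  shows "dimr mu lam = (\<Sum>i\<in>dnI lam. dimr mu (dn lam i))"
proof -
  have "dimr mu lam = (\<Sum>rho | rho \<nearrow> lam. card ((\<lambda>xs. xs @ [lam]) ` chains mu rho))"
    unfolding dimr_def chains_snoc[OF assms(2)]
  proof (rule card_UN_disjoint)
    show "\<forall>i\<in>{rho. rho \<nearrow> lam}. \<forall>j\<in>{rho. rho \<nearrow> lam}. i \<noteq> j \<longrightarrow>
      (\<lambda>xs. xs @ [lam]) ` chains mu i \<inter> (\<lambda>xs. xs @ [lam]) ` chains mu j = {}"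
      by (auto simp: chains_def)
  qed (use assms in \<open>auto simp: covers_dn_eq finite_chains\<close>)
  also have "\<dots> = (\<Sum>rho | rho \<nearrow> lam. dimr mu rho)"
    by (intro sum.cong) (auto simp: dimr_def inj_on_def intro!: card_image)
  finally show ?thesis by (simp add: sum_covers_dn assms(1))
qed

lemma dimr_eq_0:
  assumes "sum_list lam < sum_list mu \<or> (sum_list lam = sum_list mu \<and> mu \<noteq> lam)"
  shows "dimr mu lam = 0"
proof -
  have "chains mu lam = {}"
  proof (rule ccontr)
    assume "chains mu lam \<noteq> {}"
    then obtain xs where xs: "xs \<in> chains mu lam" by blast
    then have "xs \<noteq> []" by (simp add: chains_def)
    then have "length xs \<ge> 1" by (cases xs) auto
    then have "length xs = 1" "sum_list lam = sum_list mu"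
      using chains_sum_list[OF xs] assms by auto
    then show False using assms xs by (auto simp: chains_def length_Suc_conv)
  qed
  then show ?thesis by (simp add: dimr_def)
qed

lemma dnI_nonempty: "young lam \<Longrightarrow> lam \<noteq> [] \<Longrightarrow> length lam - 1 \<in> dnI lam"
  using row_eq_0_iff[of lam "length lam - 1"] by (cases lam) (auto simp: dnI_def)

lemma dimY_pos: "young lam \<Longrightarrow> 0 < dimY lam"
proof (induction "sum_list lam" arbitrary: lam rule: less_induct)
  case less
  show ?case
  proof (cases "lam = []")
    case True then show ?thesis by (simp add: dimY_def dimr_self)
  next
    case False
    let ?i = "length lam - 1"
    have i: "?i \<in> dnI lam" using dnI_nonempty less.prems False by blast
    have "0 < dimY (dn lam ?i)"
      by (rule less.hyps) (use sum_list_dn[OF less.prems i] young_dn[OF less.prems i] in auto)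
    also have "\<dots> \<le> (\<Sum>i\<in>dnI lam. dimY (dn lam i))"
      using i by (intro member_le_sum) auto
    also have "\<dots> = dimY lam"
      unfolding dimY_def using dimr_rec less.prems False by metis
    finally show ?thesis .
  qed
qed

section \<open>Content sums\<close>

text \<open>With rows numbered from \<open>0\<close>, \<open>xc l i\<close> is the content of the box that can be added in
  row \<open>i\<close>, and \<open>xc l i - 1\<close> that of the last box of row \<open>i\<close>.\<close>
definition xc :: "nat list \<Rightarrow> nat \<Rightarrow> real" where
  "xc l i = real (row l i) - real i"

text \<open>Subtracting the value of the empty row makes the sum independent of how many rows are
  taken. Telescoping along rows, it is the sum of \<open>\<phi> (c + 1) - \<phi> c\<close> over the
  contents \<open>c\<close> of all boxes.\<close>

definition csum :: "(real \<Rightarrow> real) \<Rightarrow> nat list \<Rightarrow> real" where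
  "csum \<phi> l = (\<Sum>i<length l. \<phi> (xc l i) - \<phi> (- real i))"

lemma xc_length: "length l \<le> i \<Longrightarrow> xc l i = - real i"
  by (simp add: xc_def)

lemma csum_extend: "length l \<le> N \<Longrightarrow> csum \<phi> l = (\<Sum>i<N. \<phi> (xc l i) - \<phi> (- real i))"
  unfolding csum_def by (intro sum.mono_neutral_left) (auto simp: xc_length)

lemma csum_add: "csum (\<lambda>x. \<phi> x + \<psi> x) l = csum \<phi> l + csum \<psi> l"
  by (simp add: csum_def sum.distrib[symmetric] algebra_simps)

lemma csum_cmult: "csum (\<lambda>x. c * \<phi> x) l = c * csum \<phi> l"
  by (simp add: csum_def sum_distrib_left algebra_simps)

lemma csum_sum: "finite A \<Longrightarrow> csum (\<lambda>x. \<Sum>a\<in>A. \<phi> a x) l = (\<Sum>a\<in>A. csum (\<phi> a) l)"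
  by (induction A rule: finite_induct) (simp_all add: csum_add, simp add: csum_def)

lemma csum_snoc: "csum \<phi> (xs @ [m]) = csum \<phi> xs + \<phi> (real m - real (length xs)) - \<phi> (- real (length xs))"
proof -
  have "(\<Sum>i<length xs. \<phi> (xc (xs @ [m]) i) - \<phi> (- real i)) = csum \<phi> xs"
    unfolding csum_def by (intro sum.cong) (auto simp: xc_def row_def nth_append)
  then show ?thesis by (simp add: csum_def xc_def row_def)
qed

lemma csum_up:
  assumes "young l" "i \<in> upI l"
  shows "csum \<phi> (up l i) = csum \<phi> l + \<phi> (xc l i + 1) - \<phi> (xc l i)"
proof -
  obtain N where N: "length l \<le> N" "length (up l i) \<le> N" "i < N"
    by (rule that[of "Suc (length l + length (up l i) + i)"]) auto
  have "csum \<phi> (up l i) = (\<Sum>j<N. \<phi> (xc l j) - \<phi> (- real j) + (if j = i then \<phi> (xc l i + 1) - \<phi> (xc l i) else 0))"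
    unfolding csum_extend[OF N(2)]
    by (rule sum.cong) (auto simp: xc_def row_up[OF assms] algebra_simps)
  also have "\<dots> = csum \<phi> l + \<phi> (xc l i + 1) - \<phi> (xc l i)"
    using csum_extend[OF N(1), of \<phi>] N(3) by (simp add: sum.distrib)
  finally show ?thesis .
qed

lemma xc_dn: "young l \<Longrightarrow> i \<in> dnI l \<Longrightarrow> xc (dn l i) i = xc l i - 1"
  by (auto simp: xc_def row_dn dnI_def)

lemma xc_dn_other: "young l \<Longrightarrow> i \<in> dnI l \<Longrightarrow> j \<noteq> i \<Longrightarrow> xc (dn l i) j = xc l j"
  by (auto simp: xc_def row_dn)

lemma xc_up: "young l \<Longrightarrow> i \<in> upI l \<Longrightarrow> xc (up l i) i = xc l i + 1"
  by (auto simp: xc_def row_up)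

lemma xc_up_other: "young l \<Longrightarrow> i \<in> upI l \<Longrightarrow> j \<noteq> i \<Longrightarrow> xc (up l i) j = xc l j"
  by (auto simp: xc_def row_up)

lemma csum_dn:
  assumes "young l" "i \<in> dnI l"
  shows "csum \<phi> (dn l i) = csum \<phi> l + \<phi> (xc l i - 1) - \<phi> (xc l i)"
  using csum_up[OF young_dn[OF assms], of i \<phi>] dn_in_upI[OF assms] xc_dn[OF assms] by simp

text \<open>The subtracted values at \<open>- real j\<close> telescope to
  \<open>\<phi> 0 - \<phi> (- real N)\<close>, and the last term is cancelled by the additional row
  \<open>N\<close>, which is empty.\<close>

lemma sum_xc_interlacing:
  assumes "length l \<le> N"
  shows "(\<Sum>j<Suc N. \<phi> (xc l j)) - (\<Sum>j<N. \<phi> (xc l j - 1)) = \<phi> 0 + csum (\<lambda>x. \<phi> x - \<phi> (x - 1)) l"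
proof -
  have tel: "(\<Sum>j<n. \<phi> (- real j) - \<phi> (- real j - 1)) = \<phi> 0 - \<phi> (- real n)" for n
  proof (induction n)
    case (Suc n)
    have "- real (Suc n) = - real n - 1" by simp
    then show ?case using Suc by (simp only: sum.lessThan_Suc)
  qed simp
  have "csum (\<lambda>x. \<phi> x - \<phi> (x - 1)) l
      = (\<Sum>j<N. \<phi> (xc l j)) - (\<Sum>j<N. \<phi> (xc l j - 1)) - (\<Sum>j<N. \<phi> (- real j) - \<phi> (- real j - 1))"
    by (simp add: csum_extend[OF assms] sum_subtractf)
  then show ?thesis
    by (simp add: tel xc_length[OF assms])
qed

lemma downward_closed_eq:
  fixes A :: "nat set"
  assumes "finite A" "A \<subseteq> {1..}" "\<And>i j. i \<in> A \<Longrightarrow> 1 \<le> j \<Longrightarrow> j \<le> i \<Longrightarrow> j \<in> A"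
  shows "A = {1..card A}"
proof (cases "A = {}")
  case False
  have "A = {1..Max A}"
  proof
    show "A \<subseteq> {1..Max A}" using assms(1,2) by auto
    show "{1..Max A} \<subseteq> A" using assms(3)[OF Max_in[OF assms(1) False]] by auto
  qed
  then show ?thesis by (metis card_atLeastAtMost diff_Suc_1)
qed simp

lemma diag_set_eq:
  assumes "young l"
  shows "{i. 1 \<le> i \<and> i \<le> length l \<and> i \<le> l ! (i - 1)} = {1..diag_len l}"
  unfolding diag_len_def
proof (rule downward_closed_eq)
  fix i j assume i: "i \<in> {i. 1 \<le> i \<and> i \<le> length l \<and> i \<le> l ! (i - 1)}" and j: "1 \<le> j" "j \<le> i"
  have "l ! (i - 1) \<le> l ! (j - 1)"
  proof -
    have "row l (i - 1) \<le> row l (j - 1)" using j by (intro row_mono[OF assms]) simp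
    moreover have "i - 1 < length l" "j - 1 < length l" using i j by auto
    ultimately show ?thesis by (simp add: row_def)
  qed
  with i j show "j \<in> {i. 1 \<le> i \<and> i \<le> length l \<and> i \<le> l ! (i - 1)}" by auto
qed auto

lemma young_snocD:
  assumes "young (xs @ [m])"
  shows "young xs" "1 \<le> m" "\<And>x. x \<in> set xs \<Longrightarrow> m \<le> x"
  using assms by (auto simp: young_def sorted_wrt_append)

lemma psum_altdef:
  "1 \<le> k \<Longrightarrow> psum k l = (\<Sum>i=1..diag_len l. frob_a l i ^ k - (- frob_b l i) ^ k)"
proof -
  assume "1 \<le> k"
  then have "(-1) ^ (k - 1) * y ^ k = - ((- y) ^ k)" for y :: real
    by (cases k) (simp_all add: power_minus[of y])
  then show ?thesis by (simp add: psum_def)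
qed

text \<open>Induction on the rows, appending a shortest row of length \<open>m\<close> below
  \<open>L\<close> rows. Columns \<open>j \<le> m\<close> are full, so their leg coordinates are
  explicit and the change of the power sum telescopes. The half-integers of the Frobenius
  coordinates become the shift by \<open>1/2\<close>.\<close>

lemma psum_eq_csum:
  assumes "1 \<le> k" "young l"
  shows "psum k l = csum (\<lambda>x. (x - 1/2) ^ k) l"
  using assms(2)
proof (induction l rule: rev_induct)
  case Nil
  have "diag_len [] = 0" by (simp add: diag_len_def)
  then show ?case by (simp add: psum_def csum_def)
next
  case (snoc m xs)
  note y = young_snocD[OF snoc.prems]
  define L where "L = length xs"
  have IH: "psum k xs = csum (\<lambda>x. (x - 1/2) ^ k) xs" using snoc.IH y(1) by blast
  have conj: "conj_len (xs @ [m]) j = conj_len xs j + (if j \<le> m then 1 else 0)" for j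
    by (simp add: conj_len_def)
  have conj_full: "conj_len xs j = L" if "j \<le> m" for j
  proof -
    have "filter (\<lambda>x. j \<le> x) xs = xs" using y(3) that by (fastforce simp: filter_id_conv)
    then show ?thesis by (simp add: conj_len_def L_def)
  qed
  have b_le: "frob_b xs j = real L - real j + 1/2"
             "frob_b (xs @ [m]) j = real L + 1 - real j + 1/2" if "j \<le> m" for j
    using that by (simp_all add: frob_b_def conj conj_full)
  have b_gt: "frob_b (xs @ [m]) j = frob_b xs j" if "m < j" for j
    using that by (simp add: frob_b_def conj)
  have a_le: "frob_a (xs @ [m]) j = frob_a xs j" if "1 \<le> j" "j \<le> L" for j
    using that by (simp add: frob_a_def nth_append L_def less_eq_Suc_le)
  have tel: "(\<Sum>j=1..n. (- (real L + 1 - real j + 1/2)) ^ k - (- (real L - real j + 1/2)) ^ k)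
      = (- real L - 1/2) ^ k - (real n - real L - 1/2) ^ k" for n
    by (induction n) (simp_all add: algebra_simps)
  have D: "{i. 1 \<le> i \<and> i \<le> L \<and> i \<le> xs ! (i - 1)} = {1..diag_len xs}"
    using diag_set_eq[OF y(1)] by (simp add: L_def)
  have le_row: "m \<le> xs ! (i - 1)" if "1 \<le> i" "i \<le> L" for i
    using y(3)[of "xs ! (i - 1)"] that by (simp add: L_def)
  have target: "csum (\<lambda>x. (x - 1/2) ^ k) (xs @ [m])
      = psum k xs + (real m - real L - 1/2) ^ k - (- real L - 1/2) ^ k"
    by (simp add: csum_snoc IH L_def)
  have sub: "diag_len xs \<le> L"
  proof (cases "diag_len xs = 0")
    case False
    then have "diag_len xs \<in> {i. 1 \<le> i \<and> i \<le> L \<and> i \<le> xs ! (i - 1)}" unfolding D by simp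
    then show ?thesis by simp
  qed simp
  show ?case
  proof (cases "m \<le> L")
    case True
    \<comment> \<open>A row with \<open>m \<le> L\<close> meets no new diagonal box; it lengthens
      the legs \<open>1..m\<close> only, and all of these belong to diagonal boxes.\<close>
    have "m \<in> {i. 1 \<le> i \<and> i \<le> L \<and> i \<le> xs ! (i - 1)}" using True y(2) le_row by simp
    then have md: "m \<le> diag_len xs" unfolding D by simp
    have "{i. 1 \<le> i \<and> i \<le> length (xs @ [m]) \<and> i \<le> (xs @ [m]) ! (i - 1)}
        = {i. 1 \<le> i \<and> i \<le> L \<and> i \<le> xs ! (i - 1)}"
      using True by (auto simp: nth_append L_def split: if_splits)
    then have dl: "diag_len (xs @ [m]) = diag_len xs" by (simp add: diag_len_def L_def)
    have "psum k (xs @ [m]) - psum k xs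
        = (\<Sum>j=1..diag_len xs. (- frob_b xs j) ^ k - (- frob_b (xs @ [m]) j) ^ k)"
      unfolding psum_altdef[OF assms(1)] dl sum_subtractf[symmetric]
      by (intro sum.cong) (use sub a_le in auto)
    also have "\<dots> = (\<Sum>j=1..m. (- frob_b xs j) ^ k - (- frob_b (xs @ [m]) j) ^ k)"
      by (intro sum.mono_neutral_right) (use md b_gt in auto)
    also have "\<dots> = - (\<Sum>j=1..m. (- (real L + 1 - real j + 1/2)) ^ k - (- (real L - real j + 1/2)) ^ k)"
      unfolding sum_negf[symmetric] by (intro sum.cong) (use b_le in auto)
    finally show ?thesis unfolding target tel by simp
  next
    case False
    \<comment> \<open>Here all earlier rows are longer than \<open>L\<close>, so each meets the
      diagonal, and the appended row adds one diagonal box whose leg coordinate is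
      \<open>1/2\<close>.\<close>
    have "{1..diag_len xs} = {1..L}"
      unfolding D[symmetric] using False le_row by fastforce
    then have d: "diag_len xs = L" by (metis card_atLeastAtMost diff_Suc_1)
    have "{i. 1 \<le> i \<and> i \<le> length (xs @ [m]) \<and> i \<le> (xs @ [m]) ! (i - 1)} = {1..Suc L}"
      using False le_row by (fastforce simp: nth_append L_def)
    then have dl: "diag_len (xs @ [m]) = Suc L" by (simp add: diag_len_def)
    have "psum k (xs @ [m]) - psum k xs = (\<Sum>j=1..L. (- frob_b xs j) ^ k - (- frob_b (xs @ [m]) j) ^ k)
        + (frob_a (xs @ [m]) (Suc L) ^ k - (- frob_b (xs @ [m]) (Suc L)) ^ k)"
    proof -
      have "(\<Sum>j=1..L. frob_a (xs @ [m]) j ^ k - (- frob_b (xs @ [m]) j) ^ k)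
          - (\<Sum>j=1..L. frob_a xs j ^ k - (- frob_b xs j) ^ k)
          = (\<Sum>j=1..L. (- frob_b xs j) ^ k - (- frob_b (xs @ [m]) j) ^ k)"
        unfolding sum_subtractf[symmetric] by (intro sum.cong) (use a_le in auto)
      then show ?thesis unfolding psum_altdef[OF assms(1)] dl d by simp
    qed
    also have "(\<Sum>j=1..L. (- frob_b xs j) ^ k - (- frob_b (xs @ [m]) j) ^ k)
        = - (\<Sum>j=1..L. (- (real L + 1 - real j + 1/2)) ^ k - (- (real L - real j + 1/2)) ^ k)"
      unfolding sum_negf[symmetric] by (intro sum.cong) (use b_le False in auto)
    also have "frob_a (xs @ [m]) (Suc L) = real m - real L - 1/2"
      by (simp add: frob_a_def L_def)
    also have "frob_b (xs @ [m]) (Suc L) = 1/2"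
      using False by (subst b_le) auto
    finally show ?thesis unfolding target tel by simp
  qed
qed

lemma psum_1: "young l \<Longrightarrow> psum 1 l = real (sum_list l)"
  by (simp add: psum_eq_csum csum_def xc_def sum_list_row[of l "length l"])

section \<open>The algebra of functions on diagrams\<close>

text \<open>Elements of \<open>Lam\<close> vanish on lists that are not diagrams. Cutting off makes
  membership depend on the values at diagrams only, so formulas such as \<open>csum\<close> can be
  used as they stand.\<close>

definition in_Lam :: "(nat list \<Rightarrow> real) \<Rightarrow> bool" where
  "in_Lam f \<longleftrightarrow> (\<lambda>l. if young l then f l else 0) \<in> Lam"

lemma Lam_not_young: "f \<in> Lam \<Longrightarrow> \<not> young l \<Longrightarrow> f l = 0"
  by (induction rule: Lam.induct) auto

lemma in_Lam_iff: "(\<And>l. \<not> young l \<Longrightarrow> f l = 0) \<Longrightarrow> in_Lam f \<longleftrightarrow> f \<in> Lam"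
proof -
  assume "\<And>l. \<not> young l \<Longrightarrow> f l = 0"
  then have "(\<lambda>l. if young l then f l else 0) = f" by auto
  then show ?thesis by (simp add: in_Lam_def)
qed

lemma in_Lam_cong: "(\<And>l. young l \<Longrightarrow> f l = g l) \<Longrightarrow> in_Lam f \<longleftrightarrow> in_Lam g"
  unfolding in_Lam_def by (auto cong: if_cong)

lemma in_Lam_const [intro]: "in_Lam (\<lambda>l. c)"
  unfolding in_Lam_def by (rule Lam.const)

lemma in_Lam_add [intro]: "in_Lam f \<Longrightarrow> in_Lam g \<Longrightarrow> in_Lam (\<lambda>l. f l + g l)"
  unfolding in_Lam_def by (drule (1) Lam.add) (simp add: if_distrib if_distribR cong: if_cong)

lemma in_Lam_mult [intro]: "in_Lam f \<Longrightarrow> in_Lam g \<Longrightarrow> in_Lam (\<lambda>l. f l * g l)"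
  unfolding in_Lam_def by (drule (1) Lam.mult) (simp add: if_distrib if_distribR cong: if_cong)

lemma in_Lam_sum [intro]: "(\<And>a. a \<in> A \<Longrightarrow> in_Lam (f a)) \<Longrightarrow> in_Lam (\<lambda>l. \<Sum>a\<in>A. f a l)"
  by (induction A rule: infinite_finite_induct) auto

lemma in_Lam_csum_half: "in_Lam (csum (\<lambda>x. (x - 1/2) ^ k))"
proof (cases "k = 0")
  case True
  then have "csum (\<lambda>x. (x - 1/2) ^ k) = (\<lambda>l. 0)" by (simp add: csum_def fun_eq_iff)
  then show ?thesis by auto
next
  case False
  then have "in_Lam (psum k)" unfolding in_Lam_def by (intro Lam.gen) simp
  then show ?thesis using False in_Lam_cong[of "psum k"] psum_eq_csum[of k] by auto
qed

lemma in_Lam_csum_power: "in_Lam (csum (\<lambda>x. x ^ k))"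
proof -
  have "csum (\<lambda>x. x ^ k) l
      = (\<Sum>r\<le>k. real (k choose r) * (1/2) ^ (k - r) * csum (\<lambda>x. (x - 1/2) ^ r) l)" for l
  proof -
    have "x ^ k = (\<Sum>r\<le>k. (real (k choose r) * (1/2) ^ (k - r)) * (x - 1/2) ^ r)" for x :: real
      using binomial_ring[of "x - 1/2" "1/2" k] by (simp add: mult_ac)
    then show ?thesis by (simp only: csum_sum[OF finite_atMost] csum_cmult)
  qed
  then have "csum (\<lambda>x. x ^ k) = (\<lambda>l. \<Sum>r\<le>k. real (k choose r) * (1/2) ^ (k - r) * csum (\<lambda>x. (x - 1/2) ^ r) l)"
    by auto
  then show ?thesis by (auto simp only: intro!: in_Lam_sum in_Lam_mult in_Lam_csum_half)
qed

lemma in_Lam_csum_poly: "in_Lam (csum (poly p))"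
proof -
  have "csum (poly p) = (\<lambda>l. \<Sum>i\<le>degree p. coeff p i * csum (\<lambda>x. x ^ i) l)"
    unfolding poly_altdef[abs_def]
    by (rule ext) (simp only: csum_sum[OF finite_atMost] csum_cmult)
  then show ?thesis by (auto simp only: intro!: in_Lam_sum in_Lam_mult in_Lam_csum_power)
qed

text \<open>This equals the power sum of the contents of the addable boxes minus that of the removable boxes
  (Kerov's interlacing coordinates), because the other rows cancel.\<close>
definition hsum :: "nat \<Rightarrow> nat list \<Rightarrow> real" where
  "hsum k l = (\<Sum>j<Suc (length l). xc l j ^ k) - (\<Sum>j<length l. (xc l j - 1) ^ k)"

lemma hsum_eq_csum: "hsum k l = 0 ^ k + csum (\<lambda>x. x ^ k - (x - 1) ^ k) l"
  unfolding hsum_def by (rule sum_xc_interlacing) simp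

lemma hsum_extend:
  "length l \<le> N \<Longrightarrow> hsum k l = (\<Sum>j<Suc N. xc l j ^ k) - (\<Sum>j<N. (xc l j - 1) ^ k)"
  unfolding hsum_eq_csum by (rule sum_xc_interlacing[symmetric])

lemma in_Lam_hsum: "in_Lam (hsum k)"
proof -
  have "hsum k = (\<lambda>l. 0 ^ k + csum (poly (monom 1 k - pcompose (monom 1 k) [:-1, 1:])) l)"
    unfolding hsum_eq_csum[abs_def]
    by (simp add: poly_pcompose poly_monom csum_def minus_diff_commute)
  then show ?thesis by (auto intro!: in_Lam_csum_poly)
qed

text \<open>The two interlacing sequences have equal sums; this removes the unknown constant in the
  expansion for the down weights. The second moment fixes the total of those weights.\<close>

lemma hsum_1: "young l \<Longrightarrow> hsum 1 l = 0"
  unfolding hsum_eq_csum by (simp add: csum_def)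

lemma hsum_2: "young l \<Longrightarrow> hsum 2 l = 2 * real (sum_list l)"
proof -
  assume y: "young l"
  have "hsum 2 l = csum (\<lambda>x. 2 * x + (- 1)) l"
    unfolding hsum_eq_csum
    by (simp add: power2_eq_square algebra_simps)
  also have "\<dots> = 2 * csum (\<lambda>x. x) l" by (simp add: csum_def sum_distrib_left algebra_simps)
  also have "csum (\<lambda>x. x) l = real (sum_list l)"
    by (simp add: csum_def xc_def sum_list_row[of l "length l"])
  finally show ?thesis .
qed

section \<open>Polynomials in a content with coefficients in \<open>Lam\<close>\<close>

inductive_set PL :: "(nat list \<Rightarrow> real \<Rightarrow> real) set" where
  PL_mono: "in_Lam g \<Longrightarrow> (\<lambda>l x. g l * x ^ k) \<in> PL"
| PL_add: "F \<in> PL \<Longrightarrow> G \<in> PL \<Longrightarrow> (\<lambda>l x. F l x + G l x) \<in> PL"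

lemma PL_mult_mono: "F \<in> PL \<Longrightarrow> in_Lam g \<Longrightarrow> (\<lambda>l x. F l x * (g l * x ^ k)) \<in> PL"
proof (induction rule: PL.induct)
  case (PL_mono h m)
  have "(\<lambda>l x. (h l * g l) * x ^ (m + k)) \<in> PL"
    by (rule PL.PL_mono) (use PL_mono in auto)
  then show ?case by (simp add: power_add mult_ac)
next
  case (PL_add F G)
  then show ?case using PL.PL_add by (fastforce simp: algebra_simps)
qed

lemma PL_mult: "G \<in> PL \<Longrightarrow> F \<in> PL \<Longrightarrow> (\<lambda>l x. F l x * G l x) \<in> PL"
proof (induction rule: PL.induct)
  case (PL_mono g k)
  then show ?case by (intro PL_mult_mono)
next
  case (PL_add G H)
  then show ?case using PL.PL_add by (fastforce simp: algebra_simps)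
qed

lemma PL_const: "in_Lam g \<Longrightarrow> (\<lambda>l x. g l) \<in> PL"
  using PL_mono[of g 0] by simp

lemma PL_power: "(\<lambda>l x. x ^ k) \<in> PL"
  using PL_mono[of "\<lambda>l. 1" k] by auto

lemma PL_sum: "finite A \<Longrightarrow> (\<And>a. a \<in> A \<Longrightarrow> F a \<in> PL) \<Longrightarrow> (\<lambda>l x. \<Sum>a\<in>A. F a l x) \<in> PL"
proof (induction A rule: finite_induct)
  case empty
  show ?case using PL_const[of "\<lambda>l. 0"] by auto
next
  case (insert a A)
  then show ?case using PL_add[of "F a" "\<lambda>l x. \<Sum>a\<in>A. F a l x"] by simp
qed

lemma PL_poly: "(\<lambda>l x. poly p x) \<in> PL"
  unfolding poly_altdef[abs_def]
  by (intro PL_sum PL_mult PL_power PL_const) auto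

text \<open>\<open>T l i\<close> stands for the diagram changed in row \<open>i\<close>,
  \<open>R\<close> for the admissible rows and \<open>X\<close> for the content; one induction
  serves both directions. The hypothesis also yields that \<open>T l i\<close> is a diagram, which
  the constants of \<open>Lam\<close> require.\<close>

lemma Lam_shift:
  assumes "f \<in> Lam"
    and psum: "\<And>k. 1 \<le> k \<Longrightarrow> \<exists>F\<in>PL. \<forall>l i. young l \<longrightarrow> R l i \<longrightarrow> young (T l i) \<and> psum k (T l i) = F l (X l i)"
  shows "\<exists>F\<in>PL. \<forall>l i. young l \<longrightarrow> R l i \<longrightarrow> f (T l i) = F l (X l i)"
  using assms(1)
proof (induction rule: Lam.induct)
  case (const c)
  have "(\<lambda>l x. c) \<in> PL" by (rule PL_const) auto
  then show ?case using psum[of 1] by (auto intro!: bexI[of _ "\<lambda>l x. c"])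
next
  case (gen k)
  then show ?case using psum[of k] by fastforce
next
  case (add f g)
  then obtain F G where "F \<in> PL" "G \<in> PL" "\<forall>l i. young l \<longrightarrow> R l i \<longrightarrow> f (T l i) = F l (X l i)"
    "\<forall>l i. young l \<longrightarrow> R l i \<longrightarrow> g (T l i) = G l (X l i)" by blast
  then show ?case by (intro bexI[of _ "\<lambda>l x. F l x + G l x"]) (auto intro: PL_add)
next
  case (mult f g)
  then obtain F G where "F \<in> PL" "G \<in> PL" "\<forall>l i. young l \<longrightarrow> R l i \<longrightarrow> f (T l i) = F l (X l i)"
    "\<forall>l i. young l \<longrightarrow> R l i \<longrightarrow> g (T l i) = G l (X l i)" by blast
  then show ?case by (intro bexI[of _ "\<lambda>l x. F l x * G l x"]) (auto intro: PL_mult)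
qed

lemma Lam_up:
  assumes "f \<in> Lam"
  obtains F where "F \<in> PL" "\<And>l i. young l \<Longrightarrow> i \<in> upI l \<Longrightarrow> f (up l i) = F l (xc l i)"
proof -
  have "\<exists>F\<in>PL. \<forall>l i. young l \<longrightarrow> i \<in> upI l \<longrightarrow> f (up l i) = F l (xc l i)"
  proof (rule Lam_shift[OF assms])
    fix k :: nat assume k: "1 \<le> k"
    let ?F = "\<lambda>l x. csum (\<lambda>x. (x - 1/2) ^ k) l + poly ([:1/2, 1:] ^ k - [:-1/2, 1:] ^ k) x"
    have "?F \<in> PL" by (intro PL_add PL_const in_Lam_csum_half PL_poly)
    moreover have "psum k (up l i) = ?F l (xc l i)" if "young l" "i \<in> upI l" for l i
      using psum_eq_csum[OF k young_up[OF that]] csum_up[OF that]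
      by (simp add: poly_power algebra_simps)
    ultimately show "\<exists>F\<in>PL. \<forall>l i. young l \<longrightarrow> i \<in> upI l \<longrightarrow> young (up l i) \<and> psum k (up l i) = F l (xc l i)"
      by (intro bexI[of _ ?F] allI impI conjI) (simp_all only: young_up)
  qed
  then show ?thesis using that by blast
qed

text \<open>The variable is the content of the removed box, \<open>xc l i - 1\<close>, so the
  polynomial is the negative of the one for adding a box.\<close>

lemma Lam_dn:
  assumes "f \<in> Lam"
  obtains F where "F \<in> PL" "\<And>l i. young l \<Longrightarrow> i \<in> dnI l \<Longrightarrow> f (dn l i) = F l (xc l i - 1)"
proof -
  have "\<exists>F\<in>PL. \<forall>l i. young l \<longrightarrow> i \<in> dnI l \<longrightarrow> f (dn l i) = F l (xc l i - 1)"
  proof (rule Lam_shift[OF assms])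
    fix k :: nat assume k: "1 \<le> k"
    let ?F = "\<lambda>l x. csum (\<lambda>x. (x - 1/2) ^ k) l + poly ([:-1/2, 1:] ^ k - [:1/2, 1:] ^ k) x"
    have "?F \<in> PL" by (intro PL_add PL_const in_Lam_csum_half PL_poly)
    moreover have "psum k (dn l i) = ?F l (xc l i - 1)" if "young l" "i \<in> dnI l" for l i
      using psum_eq_csum[OF k young_dn[OF that]] csum_dn[OF that]
      by (simp add: poly_power algebra_simps)
    ultimately show "\<exists>F\<in>PL. \<forall>l i. young l \<longrightarrow> i \<in> dnI l \<longrightarrow> young (dn l i) \<and> psum k (dn l i) = F l (xc l i - 1)"
      by (intro bexI[of _ ?F] allI impI conjI) (simp_all only: young_dn)
  qed
  then show ?thesis using that by blast
qed

section \<open>Partial fractions and Newton's recursion\<close>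

text \<open>Lagrange interpolation: both sides have degree below \<open>card I\<close> and agree
  with \<open>p\<close> at the \<open>card I\<close> distinct roots of \<open>q\<close>.\<close>

lemma partial_fractions_poly:
  fixes v :: "nat \<Rightarrow> real" and p :: "real poly"
  assumes I: "finite I" and inj: "inj_on v I"
  defines "q \<equiv> \<Prod>i\<in>I. [:- v i, 1:]"
  shows "p mod q = (\<Sum>i\<in>I. smult (poly p (v i) / (\<Prod>j\<in>I - {i}. v i - v j)) (\<Prod>j\<in>I - {i}. [:- v j, 1:]))"
    (is "_ = ?L")
proof (cases "I = {}")
  case True then show ?thesis by (simp add: q_def)
next
  case False
  have dq: "degree q = card I" unfolding q_def by (simp add: degree_prod_sum_eq)
  then have "q \<noteq> 0" using False I by (metis card_0_eq degree_0)
  have pq: "poly q (v i) = 0" if "i \<in> I" for i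
    using that I by (auto simp: q_def poly_prod)
  have pL: "poly ?L (v i) = poly p (v i)" if i: "i \<in> I" for i
  proof -
    have "poly ?L (v i) = (\<Sum>k\<in>I. poly p (v k) / (\<Prod>j\<in>I - {k}. v k - v j) * (\<Prod>j\<in>I - {k}. v i - v j))"
      by (simp add: poly_sum poly_prod)
    also have "\<dots> = (\<Sum>k\<in>I. if k = i then poly p (v i) else 0)"
    proof (rule sum.cong)
      fix k assume k: "k \<in> I"
      show "poly p (v k) / (\<Prod>j\<in>I - {k}. v k - v j) * (\<Prod>j\<in>I - {k}. v i - v j) = (if k = i then poly p (v i) else 0)"
      proof (cases "k = i")
        case True
        have "(\<Prod>j\<in>I - {i}. v i - v j) \<noteq> 0"
          using I inj i by (auto simp: inj_on_def)
        then show ?thesis using True by simp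
      next
        case False
        then have "(\<Prod>j\<in>I - {k}. v i - v j) = 0" using I i by (auto intro!: prod_zero)
        then show ?thesis using False by simp
      qed
    qed simp
    finally show ?thesis using I i by simp
  qed
  have card_pos: "card I > 0" using False I by (simp add: card_gt_0_iff)
  have dL: "degree ?L < card I"
  proof -
    have "degree ?L \<le> card I - 1"
    proof (rule degree_sum_le[OF I])
      fix i assume i: "i \<in> I"
      have "degree (\<Prod>j\<in>I - {i}. [:- v j, 1:]) = card I - 1"
        using i I by (simp add: degree_prod_sum_eq)
      then show "degree (smult (poly p (v i) / (\<Prod>j\<in>I - {i}. v i - v j)) (\<Prod>j\<in>I - {i}. [:- v j, 1:])) \<le> card I - 1"
        by (metis degree_smult_le)
    qed
    then show ?thesis using card_pos by simp
  qed
  have dm: "degree (p mod q) < card I"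
    using degree_mod_less[OF \<open>q \<noteq> 0\<close>, of p] dq card_pos by auto
  have cardv: "card (v ` I) = card I" using inj by (rule card_image)
  show ?thesis
  proof (rule poly_eqI_degree[of "v ` I"])
    fix x assume "x \<in> v ` I"
    then obtain i where i: "i \<in> I" "x = v i" by blast
    have "poly p x = poly (p div q * q + p mod q) x" by simp
    also have "\<dots> = poly (p div q) x * poly q x + poly (p mod q) x" by (simp only: poly_add poly_mult)
    also have "\<dots> = poly (p mod q) x" using pq i by simp
    finally show "poly (p mod q) x = poly ?L x" using pL i by simp
  qed (use cardv dm dL in auto)
qed

text \<open>Multiplication by the variable removes the exceptional point. The identities below are
  checked after \<open>u\<close> is replaced by \<open>inverse u\<close>, which leaves out
  \<open>0\<close>.\<close>

lemma poly_eqI_nonzero: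
  fixes p q :: "real poly"
  assumes "\<And>u. u \<noteq> 0 \<Longrightarrow> poly p u = poly q u"
  shows "p = q"
proof -
  have "poly (pCons 0 (p - q)) u = poly 0 u" for u using assms by (cases "u = 0") auto
  then have "pCons 0 (p - q) = 0" using poly_eq_poly_eq_iff by blast
  then show ?thesis by simp
qed

definition lin :: "real \<Rightarrow> real fps" where
  "lin a = 1 - fps_const a * fps_X"

text \<open>The inverse of \<open>lin a\<close>. A weighted sum of such series is the generating
  series of the moments of the weights.\<close>

definition geo :: "real \<Rightarrow> real fps" where
  "geo a = Abs_fps (\<lambda>k. a ^ k)"

lemma geo_nth [simp]: "fps_nth (geo a) k = a ^ k"
  by (simp add: geo_def)

lemma lin_geo: "lin a * geo a = 1"
proof (rule fps_ext)
  fix n show "fps_nth (lin a * geo a) n = fps_nth 1 n"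
    by (cases n) (simp_all add: lin_def left_diff_distrib mult.assoc)
qed

lemma fps_of_poly_lin: "fps_of_poly [:1, - a:] = lin a"
  by (simp add: lin_def fps_of_poly_pCons fps_const_neg[symmetric] del: fps_const_neg)

lemma prod_lin_nth_0: "fps_nth (\<Prod>i\<in>A. lin (x i)) 0 = 1"
  by (induction A rule: infinite_finite_induct) (simp_all add: lin_def)

lemma lin_nz: "(\<Prod>i\<in>A. lin (x i)) \<noteq> 0"
  using prod_lin_nth_0[of x A] by auto

lemma prod_lin_inverse_poly:
  fixes u :: real
  assumes "u \<noteq> 0"
  shows "(\<Prod>j\<in>A. inverse u - x j) * u ^ card A = (\<Prod>j\<in>A. 1 - u * x j)"
proof -
  have "(\<Prod>j\<in>A. inverse u - x j) * u ^ card A = (\<Prod>j\<in>A. (inverse u - x j) * u)"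
    by (simp add: prod.distrib)
  also have "\<dots> = (\<Prod>j\<in>A. 1 - u * x j)"
    using assms by (intro prod.cong) (simp_all add: algebra_simps)
  finally show ?thesis .
qed

lemma sum_geo_times_prod_lin:
  assumes "finite I"
  shows "(\<Sum>i\<in>I. fps_const (T i) * geo (v i)) * (\<Prod>i\<in>I. lin (v i))
    = fps_of_poly (\<Sum>i\<in>I. smult (T i) (\<Prod>j\<in>I - {i}. [:1, - v j:]))"
proof -
  have "fps_of_poly (\<Sum>i\<in>I. smult (T i) (\<Prod>j\<in>I - {i}. [:1, - v j:]))
     = (\<Sum>i\<in>I. fps_const (T i) * (\<Prod>j\<in>I - {i}. lin (v j)))"
    by (simp add: fps_of_poly_sum fps_of_poly_smult fps_of_poly_prod fps_of_poly_lin)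
  also have "\<dots> = (\<Sum>i\<in>I. fps_const (T i) * geo (v i) * (\<Prod>i\<in>I. lin (v i)))"
  proof (rule sum.cong)
    fix i assume i: "i \<in> I"
    have "(\<Prod>j\<in>I. lin (v j)) = lin (v i) * (\<Prod>j\<in>I - {i}. lin (v j))"
      using i assms by (simp add: prod.remove)
    then have "geo (v i) * (\<Prod>j\<in>I. lin (v j)) = (lin (v i) * geo (v i)) * (\<Prod>j\<in>I - {i}. lin (v j))"
      by (simp add: mult_ac)
    then show "fps_const (T i) * (\<Prod>j\<in>I - {i}. lin (v j)) = fps_const (T i) * geo (v i) * (\<Prod>i\<in>I. lin (v i))"
      by (simp add: lin_geo mult.assoc)
  qed simp
  finally show ?thesis by (simp add: sum_distrib_right)
qed

text \<open>Expansion at infinity of the quotient of \<open>\<Prod>(u - y j)\<close> by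
  \<open>\<Prod>(u - x i)\<close>, times \<open>u\<close>. The numerator has the smaller degree, so
  there is no polynomial part.\<close>

lemma partial_fractions_proper:
  fixes x y :: "nat \<Rightarrow> real"
  assumes "finite I" "finite J" "inj_on x I" "card I = Suc (card J)"
  shows "(\<Sum>i\<in>I. fps_const ((\<Prod>j\<in>J. x i - y j) / (\<Prod>j\<in>I - {i}. x i - x j)) * geo (x i)) * (\<Prod>i\<in>I. lin (x i))
    = (\<Prod>j\<in>J. lin (y j))"
proof -
  define p where "p = (\<Prod>j\<in>J. [:- y j, 1:])"
  define T where "T i = (\<Prod>j\<in>J. x i - y j) / (\<Prod>j\<in>I - {i}. x i - x j)" for i
  let ?q = "\<Prod>i\<in>I. [:- x i, 1:]"
  have "degree p < degree ?q"
    using assms by (simp add: p_def degree_prod_sum_eq)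
  then have p: "p = (\<Sum>i\<in>I. smult (T i) (\<Prod>j\<in>I - {i}. [:- x j, 1:]))"
    using partial_fractions_poly[OF assms(1,3), of p] by (simp add: mod_poly_less T_def p_def poly_prod)
  have "(\<Sum>i\<in>I. smult (T i) (\<Prod>j\<in>I - {i}. [:1, - x j:])) = (\<Prod>j\<in>J. [:1, - y j:])"
  proof (rule poly_eqI_nonzero)
    fix u :: real assume u: "u \<noteq> 0"
    have "poly p (inverse u) * u ^ card J = (\<Sum>i\<in>I. T i * ((\<Prod>j\<in>I - {i}. inverse u - x j) * u ^ card J))"
      by (subst p) (simp add: poly_sum poly_prod sum_distrib_left mult_ac)
    also have "\<dots> = (\<Sum>i\<in>I. T i * (\<Prod>j\<in>I - {i}. 1 - u * x j))"
    proof (rule sum.cong)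
      fix i assume "i \<in> I"
      then have "card J = card (I - {i})" using assms by simp
      then show "T i * ((\<Prod>j\<in>I - {i}. inverse u - x j) * u ^ card J) = T i * (\<Prod>j\<in>I - {i}. 1 - u * x j)"
        using prod_lin_inverse_poly[OF u, of x "I - {i}"] by (simp only:)
    qed simp
    finally have "(\<Sum>i\<in>I. T i * (\<Prod>j\<in>I - {i}. 1 - u * x j)) = poly p (inverse u) * u ^ card J" by simp
    also have "\<dots> = (\<Prod>j\<in>J. 1 - u * y j)"
      using prod_lin_inverse_poly[OF u, of y J] by (simp add: p_def poly_prod)
    finally show "poly (\<Sum>i\<in>I. smult (T i) (\<Prod>j\<in>I - {i}. [:1, - x j:])) u = poly (\<Prod>j\<in>J. [:1, - y j:]) u"
      by (simp add: poly_sum poly_prod)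
  qed
  then show ?thesis
    using sum_geo_times_prod_lin[OF assms(1), of T x]
    by (simp add: T_def fps_of_poly_prod fps_of_poly_lin)
qed

text \<open>The numerator now has degree one more, so the polynomial part is \<open>u + c\<close>.
  Division by \<open>u\<close> and passage to the inverse variable give \<open>1 + c X\<close>, and
  the fractions acquire the factor \<open>X^2\<close>. The constant is left open; Newton's recursion
  determines it in the application.\<close>

lemma partial_fractions_degree_Suc:
  fixes v x :: "nat \<Rightarrow> real"
  assumes "finite I" "finite J" "inj_on v I" "card J = Suc (card I)"
  shows "\<exists>c. (1 + fps_const c * fps_X
      + fps_X ^ 2 * (\<Sum>i\<in>I. fps_const ((\<Prod>j\<in>J. v i - x j) / (\<Prod>j\<in>I - {i}. v i - v j)) * geo (v i)))
      * (\<Prod>i\<in>I. lin (v i)) = (\<Prod>j\<in>J. lin (x j))"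
proof -
  define p where "p = (\<Prod>j\<in>J. [:- x j, 1:])"
  define q where "q = (\<Prod>i\<in>I. [:- v i, 1:])"
  define T where "T i = (\<Prod>j\<in>J. v i - x j) / (\<Prod>j\<in>I - {i}. v i - v j)" for i
  define a where "a = p div q"
  have dp: "degree p = Suc (card I)" using assms by (simp add: p_def degree_prod_sum_eq)
  have dq: "degree q = card I" by (simp add: q_def degree_prod_sum_eq)
  have lp: "lead_coeff p = 1" by (simp add: p_def lead_coeff_prod)
  have lq: "lead_coeff q = 1" by (simp add: q_def lead_coeff_prod)
  then have "q \<noteq> 0" by auto
  have p: "p = a * q + (\<Sum>i\<in>I. smult (T i) (\<Prod>j\<in>I - {i}. [:- v j, 1:]))"
    using partial_fractions_poly[OF assms(1,3), of p, folded q_def] div_mult_mod_eq[of p q]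
    by (simp add: T_def p_def poly_prod a_def)
  have pm: "p = a * q + p mod q" by (simp add: a_def)
  have dm: "degree (p mod q) < degree p"
    using degree_mod_less[OF \<open>q \<noteq> 0\<close>, of p] dp dq by auto
  have "a \<noteq> 0" using pm dm by auto
  have "a * q = p + - (p mod q)" by (simp add: a_def minus_mod_eq_div_mult)
  then have "degree (a * q) = degree (p + - (p mod q))" by simp
  also have "\<dots> = degree p" using dm by (intro degree_add_eq_left) simp
  finally have da: "degree a = 1" using \<open>a \<noteq> 0\<close> \<open>q \<noteq> 0\<close> dp dq by (simp add: degree_mult_eq)
  have "lead_coeff p = coeff (a * q) (degree p) + coeff (p mod q) (degree p)"
    by (subst (1) pm) simp
  also have "coeff (p mod q) (degree p) = 0" using dm by (rule coeff_eq_0)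
  also have "coeff (a * q) (degree p) = lead_coeff a * lead_coeff q"
    using coeff_mult_degree_sum[of a q] da dp dq by simp
  finally have "coeff a 1 = 1" using lp lq da by simp
  moreover obtain c b where "a = pCons c b" by (rule pCons_cases)
  moreover from this have "degree b = 0" using da by (auto split: if_splits)
  \<comment> \<open>Both polynomials are monic and the degrees differ by one, so the quotient is
    monic and linear.\<close>
  ultimately have a: "a = [:c, 1:]" by (auto elim!: degree_eq_zeroE)
  have "[:1, c:] * (\<Prod>i\<in>I. [:1, - v i:]) + [:0, 0, 1:] * (\<Sum>i\<in>I. smult (T i) (\<Prod>j\<in>I - {i}. [:1, - v j:])) = (\<Prod>j\<in>J. [:1, - x j:])"
  proof (rule poly_eqI_nonzero)
    fix u :: real assume u: "u \<noteq> 0"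
    let ?w = "u ^ Suc (card I)"
    have "poly p (inverse u) * ?w = (c + inverse u) * u * ((\<Prod>i\<in>I. inverse u - v i) * u ^ card I)
       + (\<Sum>i\<in>I. T i * ((\<Prod>j\<in>I - {i}. inverse u - v j) * ?w))"
      by (subst p) (simp add: poly_sum poly_prod sum_distrib_left a q_def algebra_simps)
    also have "(c + inverse u) * u = 1 + c * u" using u by (simp add: algebra_simps)
    also have "(\<Prod>i\<in>I. inverse u - v i) * u ^ card I = (\<Prod>i\<in>I. 1 - u * v i)"
      by (rule prod_lin_inverse_poly[OF u])
    also have "(\<Sum>i\<in>I. T i * ((\<Prod>j\<in>I - {i}. inverse u - v j) * ?w)) = (\<Sum>i\<in>I. u ^ 2 * (T i * (\<Prod>j\<in>I - {i}. 1 - u * v j)))"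
    proof (rule sum.cong)
      fix i assume "i \<in> I"
      \<comment> \<open>Each cofactor lacks one of the \<open>card I\<close> factors, which leaves
        two spare powers of \<open>u\<close>.\<close>
      then have "Suc (card I) = card (I - {i}) + 2"
        using assms(1) card_gt_0_iff[of I] by (auto simp: card_Diff_singleton)
      then have "?w = u ^ card (I - {i}) * u ^ 2" by (simp only: power_add)
      then show "T i * ((\<Prod>j\<in>I - {i}. inverse u - v j) * ?w) = u ^ 2 * (T i * (\<Prod>j\<in>I - {i}. 1 - u * v j))"
        using prod_lin_inverse_poly[OF u, of v "I - {i}", symmetric] by (simp only: mult_ac)
    qed simp
    finally have "poly p (inverse u) * ?w = (1 + c * u) * (\<Prod>i\<in>I. 1 - u * v i)
       + u ^ 2 * (\<Sum>i\<in>I. T i * (\<Prod>j\<in>I - {i}. 1 - u * v j))" by (simp add: sum_distrib_left)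
    moreover have "poly p (inverse u) * ?w = (\<Prod>j\<in>J. 1 - u * x j)"
      using prod_lin_inverse_poly[OF u, of x J] assms(4) by (simp add: p_def poly_prod)
    ultimately show "poly ([:1, c:] * (\<Prod>i\<in>I. [:1, - v i:]) + [:0, 0, 1:] * (\<Sum>i\<in>I. smult (T i) (\<Prod>j\<in>I - {i}. [:1, - v j:]))) u
        = poly (\<Prod>j\<in>J. [:1, - x j:]) u"
      by (simp add: poly_sum poly_prod power2_eq_square algebra_simps)
  qed
  then have "fps_of_poly ([:1, c:] * (\<Prod>i\<in>I. [:1, - v i:]) + [:0, 0, 1:] * (\<Sum>i\<in>I. smult (T i) (\<Prod>j\<in>I - {i}. [:1, - v j:])))
      = (\<Prod>j\<in>J. lin (x j))" by (simp add: fps_of_poly_prod fps_of_poly_lin)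
  moreover have "fps_of_poly [:1, c:] = 1 + fps_const c * fps_X" "fps_of_poly [:0, 0, 1::real:] = fps_X ^ 2"
    by (simp_all add: fps_of_poly_pCons power2_eq_square)
  ultimately have "(1 + fps_const c * fps_X) * (\<Prod>i\<in>I. lin (v i))
     + fps_X ^ 2 * ((\<Sum>i\<in>I. fps_const (T i) * geo (v i)) * (\<Prod>i\<in>I. lin (v i))) = (\<Prod>j\<in>J. lin (x j))"
    by (simp only: fps_of_poly_add fps_of_poly_mult sum_geo_times_prod_lin[OF assms(1)] fps_of_poly_prod fps_of_poly_lin)
  then show ?thesis
    by (intro exI[of _ c]) (simp only: T_def ring_distribs mult.assoc)
qed

section \<open>Logarithmic derivatives and Newton's identities\<close>

text \<open>The logarithmic derivative of \<open>lin a\<close>, times the variable, is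
  \<open>1 - geo a\<close>, and logarithmic derivatives add over products.\<close>

lemma deriv_prod_lin:
  "finite A \<Longrightarrow> fps_X * fps_deriv (\<Prod>a\<in>A. lin (x a)) = - ((\<Prod>a\<in>A. lin (x a)) * (\<Sum>a\<in>A. geo (x a) - 1))"
proof (induction A rule: finite_induct)
  case (insert a A)
  let ?P = "\<Prod>a\<in>A. lin (x a)"
  have 1: "fps_X * fps_deriv (lin (x a)) = - (lin (x a) * (geo (x a) - 1))"
    using lin_geo[of "x a"] by (simp add: lin_def algebra_simps)
  have "fps_X * fps_deriv (lin (x a) * ?P) = (fps_X * fps_deriv (lin (x a))) * ?P + lin (x a) * (fps_X * fps_deriv ?P)"
    by (simp add: algebra_simps)
  also have "\<dots> = - (lin (x a) * ?P * ((geo (x a) - 1) + (\<Sum>a\<in>A. geo (x a) - 1)))"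
    unfolding 1 insert.IH by (simp add: algebra_simps)
  finally show ?case using insert by simp
qed simp

text \<open>Differentiating the product relation and cancelling the nonzero denominator gives
  \<open>X G' = G H\<close>, where \<open>H\<close> generates the differences of power sums; the
  recursion compares coefficients.\<close>

lemma newton_recursion:
  fixes x y :: "nat \<Rightarrow> real"
  assumes "finite I" "finite J" and G: "G * (\<Prod>i\<in>I. lin (x i)) = (\<Prod>j\<in>J. lin (y j))"
  shows "fps_nth G 0 = 1"
    and "real k * fps_nth G k = (\<Sum>r<k. fps_nth G r * ((\<Sum>i\<in>I. x i ^ (k - r)) - (\<Sum>j\<in>J. y j ^ (k - r))))"
proof -
  let ?E = "\<Prod>i\<in>I. lin (x i)" and ?F = "\<Prod>j\<in>J. lin (y j)"
  let ?H = "(\<Sum>i\<in>I. geo (x i) - 1) - (\<Sum>j\<in>J. geo (y j) - 1)"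
  have "fps_nth (G * ?E) 0 = fps_nth ?F 0" using G by simp
  then show "fps_nth G 0 = 1" by (simp add: prod_lin_nth_0)
  have "fps_X * fps_deriv (G * ?E) = (fps_X * fps_deriv G) * ?E + G * (fps_X * fps_deriv ?E)"
    by (simp add: algebra_simps)
  then have "(fps_X * fps_deriv G) * ?E = fps_X * fps_deriv ?F - G * (fps_X * fps_deriv ?E)"
    by (simp add: G)
  also have "\<dots> = - (G * ?E * (\<Sum>j\<in>J. geo (y j) - 1)) + G * (?E * (\<Sum>i\<in>I. geo (x i) - 1))"
    unfolding deriv_prod_lin[OF assms(1)] deriv_prod_lin[OF assms(2)] G by simp
  also have "\<dots> = (G * ?H) * ?E" by (simp add: algebra_simps)
  finally have "fps_X * fps_deriv G = G * ?H" using lin_nz[of x I] by simp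
  then have "fps_nth (fps_X * fps_deriv G) k = fps_nth (G * ?H) k" by simp
  moreover have "fps_nth (fps_X * fps_deriv G) k = real k * fps_nth G k"
    by (cases k) simp_all
  moreover have "fps_nth (G * ?H) k = (\<Sum>r<k. fps_nth G r * fps_nth ?H (k - r))"
  proof -
    have "{0..k} = insert k {..<k}" by auto
    \<comment> \<open>Without a constant term in \<open>H\<close> the summand \<open>r = k\<close>
      drops out, so only earlier coefficients occur on the right.\<close>
    moreover have "fps_nth ?H 0 = 0" by (simp add: fps_sum_nth)
    ultimately show ?thesis by (simp add: fps_mult_nth)
  qed
  moreover have "(\<Sum>r<k. fps_nth G r * fps_nth ?H (k - r))
      = (\<Sum>r<k. fps_nth G r * ((\<Sum>i\<in>I. x i ^ (k - r)) - (\<Sum>j\<in>J. y j ^ (k - r))))"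
    by (intro sum.cong) (simp_all add: fps_sum_nth)
  ultimately show "real k * fps_nth G k = (\<Sum>r<k. fps_nth G r * ((\<Sum>i\<in>I. x i ^ (k - r)) - (\<Sum>j\<in>J. y j ^ (k - r))))"
    by simp
qed

section \<open>Kerov's transition weights\<close>

text \<open>These are Kerov's formulas, except that the products run over all rows up to an arbitrary bound
  \<open>N \<ge> length l\<close> rather than over the corners: the factors of the other rows cancel.\<close>
definition upw :: "nat \<Rightarrow> nat list \<Rightarrow> nat \<Rightarrow> real" where
  "upw N l i = (\<Prod>j<N. xc l i - (xc l j - 1)) / (\<Prod>j\<in>{..<Suc N} - {i}. xc l i - xc l j)"

definition dnw :: "nat \<Rightarrow> nat list \<Rightarrow> nat \<Rightarrow> real" where
  "dnw N l i = - (\<Prod>j<Suc N. xc l i - 1 - xc l j) / (\<Prod>j\<in>{..<N} - {i}. xc l i - xc l j)"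

lemma xc_strict: "young l \<Longrightarrow> i < j \<Longrightarrow> xc l j < xc l i"
  using row_mono[of l i j] by (simp add: xc_def)

lemma inj_xc: "young l \<Longrightarrow> inj_on (xc l) A"
  by (rule inj_onI) (metis linorder_neqE_nat xc_strict less_irrefl)

lemma xc_eq_iff: "young l \<Longrightarrow> xc l i = xc l j \<longleftrightarrow> i = j"
  using inj_xc[of l UNIV] by (auto simp: inj_on_def)

text \<open>If row \<open>i\<close> is as long as the row above, the factor \<open>j = i - 1\<close>
  of the numerator is zero. For the down weights it is the factor \<open>j = i + 1\<close>.\<close>

lemma upw_not_upI:
  assumes "young l" "i \<le> N" "i \<notin> upI l"
  shows "upw N l i = 0"
proof -
  have i: "i \<noteq> 0" "row l i = row l (i - 1)"
    using assms row_mono[OF assms(1), of "i - 1" i] by (auto simp: upI_def)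
  then have "xc l i - (xc l (i - 1) - 1) = 0" by (simp add: xc_def of_nat_diff)
  then have "(\<Prod>j<N. xc l i - (xc l j - 1)) = 0"
    using i(1) assms(2) by (intro prod_zero) (auto intro!: bexI[of _ "i - 1"])
  then show ?thesis by (simp add: upw_def)
qed

lemma dnw_not_dnI:
  assumes "young l" "i < N" "i \<notin> dnI l"
  shows "dnw N l i = 0"
proof -
  have i: "row l (Suc i) = row l i"
    using assms row_mono[OF assms(1), of i "Suc i"] by (auto simp: dnI_def)
  then have "xc l i - 1 - xc l (Suc i) = 0" by (simp add: xc_def)
  then have "(\<Prod>j<Suc N. xc l i - 1 - xc l j) = 0"
    using assms(2) by (intro prod_zero) (auto intro!: bexI[of _ "Suc i"])
  then show ?thesis by (simp add: dnw_def)
qed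

lemma sum_upw:
  assumes "young l" "length l \<le> N"
  shows "(\<Sum>i<Suc N. upw N l i * f i) = (\<Sum>i\<in>upI l. upw N l i * f i)"
  by (rule sum.mono_neutral_right) (use assms upw_not_upI upI_bound in fastforce)+

lemma sum_dnw:
  assumes "young l" "length l \<le> N"
  shows "(\<Sum>i<N. dnw N l i * f i) = (\<Sum>i\<in>dnI l. dnw N l i * f i)"
  by (rule sum.mono_neutral_right) (use assms dnw_not_dnI dnI_bound in fastforce)+

definition up_moment :: "nat \<Rightarrow> nat \<Rightarrow> nat list \<Rightarrow> real" where
  "up_moment N k l = (\<Sum>i<Suc N. upw N l i * xc l i ^ k)"

definition dn_moment :: "nat \<Rightarrow> nat \<Rightarrow> nat list \<Rightarrow> real" where
  "dn_moment N k l = (\<Sum>i<N. dnw N l i * (xc l i - 1) ^ k)"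

lemma up_moment_recursion:
  assumes "young l" "length l \<le> N"
  shows "up_moment N 0 l = 1"
    and "real k * up_moment N k l = (\<Sum>r<k. up_moment N r l * hsum (k - r) l)"
proof -
  define G where "G = (\<Sum>i<Suc N. fps_const (upw N l i) * geo (xc l i))"
  have G: "fps_nth G k = up_moment N k l" for k
    by (simp add: G_def up_moment_def fps_sum_nth)
  have eq: "G * (\<Prod>i<Suc N. lin (xc l i)) = (\<Prod>j<N. lin (xc l j - 1))"
    unfolding G_def upw_def
    by (rule partial_fractions_proper) (use inj_xc[OF assms(1)] in auto)
  show "up_moment N 0 l = 1"
    using newton_recursion(1)[OF _ _ eq] by (simp add: G)
  show "real k * up_moment N k l = (\<Sum>r<k. up_moment N r l * hsum (k - r) l)"
    using newton_recursion(2)[OF _ _ eq, of k] by (simp only: G hsum_extend[OF assms(2)] finite_lessThan)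
qed

text \<open>\<open>g\<close> lists the coefficients of the inverse rational function at infinity.
  Inversion changes the sign of \<open>hsum\<close>, and the minus sign before the moments undoes
  the one in \<open>dnw\<close>, which makes the weights positive at removable rows.\<close>

lemma dn_moment_recursion:
  assumes "young l" "length l \<le> N"
  defines "g \<equiv> \<lambda>k. if k = 0 then 1 else if k = 1 then 0 else - dn_moment N (k - 2) l"
  shows "real k * g k = (\<Sum>r<k. g r * - hsum (k - r) l)"
proof -
  define v where "v i = xc l i - 1" for i
  define S where "S = (\<Sum>i<N. fps_const ((\<Prod>j<Suc N. v i - xc l j) / (\<Prod>j\<in>{..<N} - {i}. v i - v j)) * geo (v i))"
  have S: "fps_nth S k = - dn_moment N k l" for k
    unfolding S_def dn_moment_def sum_negf[symmetric] fps_sum_nth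
    by (intro sum.cong) (simp_all add: v_def dnw_def)
  have "inj_on v {..<N}" using inj_xc[OF assms(1), of "{..<N}"] by (auto simp: inj_on_def v_def)
  then obtain c where c: "(1 + fps_const c * fps_X + fps_X ^ 2 * S) * (\<Prod>i<N. lin (v i)) = (\<Prod>j<Suc N. lin (xc l j))"
    using partial_fractions_degree_Suc[of "{..<N}" "{..<Suc N}" v "xc l"] unfolding S_def by auto
  define G where "G = 1 + fps_const c * fps_X + fps_X ^ 2 * S"
  have G: "fps_nth G k = (if k = 0 then 1 else if k = 1 then c else - dn_moment N (k - 2) l)" for k
    unfolding G_def by (auto simp: S fps_X_power_mult_nth)
  have rec: "real k * fps_nth G k = (\<Sum>r<k. fps_nth G r * - hsum (k - r) l)" for k
    using newton_recursion(2)[OF _ _ c[folded G_def], of k]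
    by (simp add: hsum_extend[OF assms(2)] v_def)
  \<comment> \<open>The recursion at order one reads \<open>c = - hsum 1 l\<close>.\<close>
  have "c = 0" using rec[of 1] hsum_1[OF assms(1)] by (simp add: G)
  then have "fps_nth G = g" by (rule_tac ext) (simp add: G g_def)
  then show ?thesis using rec[of k] by simp
qed

text \<open>At order two the recursion gives twice the total as \<open>hsum 2 l\<close>, that is
  \<open>2 n\<close>.\<close>

lemma sum_dnw_total:
  assumes "young l" "length l \<le> N"
  shows "(\<Sum>i<N. dnw N l i) = real (sum_list l)"
  using dn_moment_recursion[OF assms, of 2] hsum_2[OF assms(1)]
  by (simp add: dn_moment_def numeral_2_eq_2)

lemma in_Lam_up_moment: "in_Lam (\<lambda>l. up_moment (length l) k l)"
proof (induction k rule: less_induct)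
  case (less k)
  show ?case
  proof (cases "k = 0")
    case True
    then show ?thesis using in_Lam_cong[of "\<lambda>l. up_moment (length l) k l" "\<lambda>l. 1"]
      by (auto simp: up_moment_recursion(1))
  next
    case False
    have "in_Lam (\<lambda>l. (1 / real k) * (\<Sum>r<k. up_moment (length l) r l * hsum (k - r) l))"
      by (intro in_Lam_mult in_Lam_const in_Lam_sum in_Lam_hsum less) simp
    moreover have "up_moment (length l) k l = (1 / real k) * (\<Sum>r<k. up_moment (length l) r l * hsum (k - r) l)"
      if "young l" for l
      using up_moment_recursion(2)[OF that order_refl, of k] False by (simp add: field_simps)
    ultimately show ?thesis
      using in_Lam_cong[of "\<lambda>l. up_moment (length l) k l"] by simp
  qed
qed

lemma in_Lam_dn_moment: "in_Lam (\<lambda>l. dn_moment (length l) k l)"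
proof -
  \<comment> \<open>The induction runs over the coefficients of the series instead of the moments,
    since the first two coefficients are no moments but enter the recursion.\<close>
  define g where "g k l = (if k = 0 then 1 else if k = 1 then 0 else - dn_moment (length l) (k - 2) l)" for k l
  have "in_Lam (g k)" for k
  proof (induction k rule: less_induct)
    case (less k)
    show ?case
    proof (cases "k = 0")
      case True
      then show ?thesis unfolding g_def by auto
    next
      case False
      have "in_Lam (\<lambda>l. (- 1 / real k) * (\<Sum>r<k. g r l * hsum (k - r) l))"
        by (intro in_Lam_mult in_Lam_const in_Lam_sum in_Lam_hsum less) simp
      moreover have "g k l = (- 1 / real k) * (\<Sum>r<k. g r l * hsum (k - r) l)" if "young l" for l
        using dn_moment_recursion[OF that order_refl, of k] False
        unfolding g_def by (simp add: field_simps sum_negf)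
      ultimately show ?thesis
        using in_Lam_cong[of "g k"] by simp
    qed
  qed
  from this[of "k + 2"] have "in_Lam (\<lambda>l. (- 1) * - dn_moment (length l) k l)"
    by (intro in_Lam_mult in_Lam_const) (simp add: g_def[abs_def])
  then show ?thesis by simp
qed

text \<open>The weighted sum is linear in \<open>F\<close>, and the coefficient of a monomial does
  not depend on the row, so monomials reduce to moments.\<close>

lemma in_Lam_PL_up:
  "F \<in> PL \<Longrightarrow> in_Lam (\<lambda>l. \<Sum>i<Suc (length l). upw (length l) l i * F l (xc l i))"
proof (induction rule: PL.induct)
  case (PL_mono g k)
  then have "in_Lam (\<lambda>l. g l * up_moment (length l) k l)" by (intro in_Lam_mult in_Lam_up_moment)
  then show ?case by (simp only: up_moment_def sum_distrib_left mult_ac)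
next
  case (PL_add F G)
  then show ?case using in_Lam_add by (fastforce simp: distrib_left sum.distrib simp del: sum.lessThan_Suc)
qed

lemma in_Lam_PL_dn:
  "F \<in> PL \<Longrightarrow> in_Lam (\<lambda>l. \<Sum>i<length l. dnw (length l) l i * F l (xc l i - 1))"
proof (induction rule: PL.induct)
  case (PL_mono g k)
  then have "in_Lam (\<lambda>l. g l * dn_moment (length l) k l)" by (intro in_Lam_mult in_Lam_dn_moment)
  then show ?case by (simp only: dn_moment_def sum_distrib_left mult_ac)
next
  case (PL_add F G)
  then show ?case using in_Lam_add by (fastforce simp: distrib_left sum.distrib)
qed

section \<open>The weights are quotients of dimensions\<close>

lemma dnI_dn:
  assumes "young l" "i \<in> dnI l" "k \<in> dnI l" "i \<noteq> k"
  shows "k \<in> dnI (dn l i)"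
  using assms by (auto simp: dnI_def row_dn)

lemma dn_commute:
  assumes "young l" "i \<in> dnI l" "k \<in> dnI l" "i \<noteq> k"
  shows "dn (dn l i) k = dn (dn l k) i"
proof (rule row_inject)
  note ik = dnI_dn[OF assms] dnI_dn[OF assms(1,3,2) assms(4)[symmetric]]
  note y = young_dn[OF assms(1,2)] young_dn[OF assms(1,3)]
  show "young (dn (dn l i) k)" "young (dn (dn l k) i)"
    using young_dn y ik by auto
  show "row (dn (dn l i) k) = row (dn (dn l k) i)"
    using assms by (auto simp: row_dn[OF y(1) ik(1)] row_dn[OF y(2) ik(2)] row_dn fun_eq_iff)
qed

text \<open>Contents of distinct removable boxes differ by at least \<open>2\<close>; this keeps the
  denominators \<open>d - 1\<close>, \<open>d\<close>, \<open>d + 1\<close> of the next computation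
  away from zero.\<close>

lemma dnI_gap:
  assumes "young l" "i \<in> dnI l" "k \<in> dnI l" "i \<noteq> k"
  shows "xc l i - xc l k \<noteq> 1" "xc l i - xc l k \<noteq> 0" "xc l i - xc l k \<noteq> -1"
proof -
  have gap: "xc l a - xc l b \<ge> 2" if "a \<in> dnI l" "a < b" for a b
    using that row_mono[OF assms(1), of "Suc a" b] by (simp add: xc_def dnI_def)
  show "xc l i - xc l k \<noteq> 1" "xc l i - xc l k \<noteq> 0" "xc l i - xc l k \<noteq> -1"
    using gap[of i k] gap[of k i] assms by (cases "i < k"; force)+
qed

text \<open>Only the factors \<open>j = i\<close> change. With \<open>d = xc l k - xc l i\<close>,
  the numerator factor goes from \<open>d - 1\<close> to \<open>d\<close> and the denominator factor
  from \<open>d\<close> to \<open>d + 1\<close>. The resulting correction is even in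
  \<open>d\<close>, hence the symmetry in \<open>i\<close> and \<open>k\<close>.\<close>

lemma dnw_dn:
  assumes "young l" "length l \<le> N" "i \<in> dnI l" "k \<in> dnI l" "i \<noteq> k"
  shows "dnw N (dn l i) k = dnw N l k * ((xc l k - xc l i)\<^sup>2 / ((xc l k - xc l i)\<^sup>2 - 1))"
proof -
  define d where "d = xc l k - xc l i"
  let ?l = "dn l i"
  have iN: "i < N" "k < N" using dnI_bound assms by fastforce+
  have d: "d \<noteq> 1" "d \<noteq> 0" "d \<noteq> -1" using dnI_gap[OF assms(1,4,3)] assms(5) by (auto simp: d_def)
  have x: "xc ?l i = xc l i - 1" "\<And>j. j \<noteq> i \<Longrightarrow> xc ?l j = xc l j"
    using xc_dn xc_dn_other assms by auto
  define A where "A = (\<Prod>j\<in>{..<Suc N} - {i}. xc l k - 1 - xc l j)"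
  define B where "B = (\<Prod>j\<in>{..<N} - {k} - {i}. xc l k - xc l j)"
  have num: "(\<Prod>j<Suc N. xc l k - 1 - xc l j) = (d - 1) * A"
    using iN by (subst prod.remove[of _ i]) (auto simp: A_def d_def)
  have num': "(\<Prod>j<Suc N. xc ?l k - 1 - xc ?l j) = d * A"
  proof -
    have "(\<Prod>j\<in>{..<Suc N} - {i}. xc ?l k - 1 - xc ?l j) = A"
      unfolding A_def by (rule prod.cong) (use x assms in auto)
    then show ?thesis using iN assms x by (subst prod.remove[of _ i]) (auto simp: d_def)
  qed
  have den: "(\<Prod>j\<in>{..<N} - {k}. xc l k - xc l j) = d * B"
    using iN assms(5) by (subst prod.remove[of _ i]) (auto simp: B_def d_def)
  have den': "(\<Prod>j\<in>{..<N} - {k}. xc ?l k - xc ?l j) = (d + 1) * B"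
  proof -
    have "(\<Prod>j\<in>{..<N} - {k} - {i}. xc ?l k - xc ?l j) = B"
      unfolding B_def by (rule prod.cong) (use x assms in auto)
    then show ?thesis using iN assms x by (subst prod.remove[of _ i]) (auto simp: d_def)
  qed
  have "B \<noteq> 0" unfolding B_def using xc_eq_iff[OF assms(1)] by auto
  have sq: "d\<^sup>2 - 1 = (d - 1) * (d + 1)" by (simp add: power2_eq_square algebra_simps)
  show ?thesis
    unfolding dnw_def num num' den den' d_def[symmetric] sq
    using d \<open>B \<noteq> 0\<close> by (simp add: divide_simps power2_eq_square)
qed

lemma dnw_symmetric:
  assumes "young l" "length l \<le> N" "i \<in> dnI l" "k \<in> dnI l" "i \<noteq> k"
  shows "dnw N l i * dnw N (dn l i) k = dnw N l k * dnw N (dn l k) i"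
  using dnw_dn[OF assms] dnw_dn[OF assms(1,2,4,3)] assms(5)
  by (simp add: power2_commute[of "xc l i" "xc l k"])

lemma length_dn_le: "young l \<Longrightarrow> i \<in> dnI l \<Longrightarrow> length (dn l i) \<le> length l"
  using row_eq_0_iff[OF young_dn, of l i "length l"] dnI_bound[of i l] by (simp add: row_dn)

lemma length_up_le: "young l \<Longrightarrow> i \<in> upI l \<Longrightarrow> length (up l i) \<le> Suc (length l)"
  using row_eq_0_iff[OF young_up, of l i "Suc (length l)"] upI_bound[of i l] by (simp add: row_up)

lemma dimY_dn:
  assumes "young l" "length l \<le> N" "i \<in> dnI l"
  shows "real (sum_list l) * real (dimY (dn l i)) = dnw N l i * real (dimY l)"
  using assms
proof (induction "sum_list l" arbitrary: l i rule: less_induct)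
  case less
  note y = less.prems(1) and N = less.prems(2) and i = less.prems(3)
  \<comment> \<open>The diagrams without box \<open>i\<close> and without box \<open>k\<close> are
    compared through the one without both, where the induction hypothesis applies twice. Summing
    over \<open>k\<close> with the branching rule and the total \<open>n\<close> then gives the
    claim.\<close>
  have key: "dnw N l k * real (dimY (dn l i)) = dnw N l i * real (dimY (dn l k))" if k: "k \<in> dnI l" for k
  proof (cases "k = i")
    case False
    let ?s = "dn (dn l i) k"
    note ik = dnI_dn[OF y i k False[symmetric]] dnI_dn[OF y k i False]
    have len: "length (dn l i) \<le> N" "length (dn l k) \<le> N" using length_dn_le y i k N by fastforce+
    have s: "sum_list (dn l i) < sum_list l" "sum_list (dn l k) < sum_list l"
      using sum_list_dn[OF y i] sum_list_dn[OF y k] by auto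
    have eq: "sum_list (dn l i) = sum_list (dn l k)"
      using sum_list_dn[OF y i] sum_list_dn[OF y k] by linarith
    \<comment> \<open>A further box can be removed, so the smaller diagram is nonempty and the
      weight in \<open>nz\<close> is nonzero.\<close>
    have ne: "sum_list (dn l i) \<noteq> 0"
      using sum_list_dn[OF young_dn[OF y i] ik(1)] by linarith
    have 1: "real (sum_list (dn l i)) * real (dimY ?s) = dnw N (dn l i) k * real (dimY (dn l i))"
      by (rule less.hyps[OF s(1) young_dn[OF y i] len(1) ik(1)])
    have 2: "real (sum_list (dn l i)) * real (dimY ?s) = dnw N (dn l k) i * real (dimY (dn l k))"
      using less.hyps[OF s(2) young_dn[OF y k] len(2) ik(2)] dn_commute[OF y i k False[symmetric]] eq by simp
    have "dimY ?s > 0" using dimY_pos young_dn y i ik by blast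
    then have nz: "dnw N (dn l i) k \<noteq> 0" using 1 ne by auto
    have "dnw N (dn l i) k * (dnw N l i * real (dimY (dn l k)))
        = dnw N l k * (dnw N (dn l k) i * real (dimY (dn l k)))"
      using dnw_symmetric[OF y N i k False[symmetric]] by (simp add: mult_ac)
    also have "\<dots> = dnw N (dn l i) k * (dnw N l k * real (dimY (dn l i)))"
      using 1 2 by simp
    finally show ?thesis using nz by simp
  qed simp
  have "l \<noteq> []" using i by (auto simp: dnI_def)
  then have "real (dimY l) = (\<Sum>k\<in>dnI l. real (dimY (dn l k)))"
    unfolding dimY_def using dimr_rec[OF y, of "[]"] by simp
  then have "dnw N l i * real (dimY l) = (\<Sum>k\<in>dnI l. dnw N l k * real (dimY (dn l i)))"
    by (simp add: sum_distrib_left key)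
  also have "\<dots> = real (sum_list l) * real (dimY (dn l i))"
    using sum_dnw[OF y N, of "\<lambda>_. 1"] sum_dnw_total[OF y N]
    unfolding sum_distrib_right[symmetric] by simp
  finally show ?case by simp
qed

text \<open>Up to the factor \<open>j = i\<close>, the numerator of one weight is the denominator of
  the other. That factor is \<open>1\<close> in \<open>upw\<close> and \<open>-1\<close> in
  \<open>dnw\<close>, where it cancels the sign. The strict bound lets \<open>dnw\<close> reach a
  newly opened row.\<close>

lemma upw_dnw:
  assumes "young l" "length l < N" "i \<in> upI l"
  shows "upw N l i * dnw N (up l i) i = 1"
proof -
  let ?l = "up l i"
  have iN: "i < N" using upI_bound assms by fastforce
  have x: "xc ?l i = xc l i + 1" "\<And>j. j \<noteq> i \<Longrightarrow> xc ?l j = xc l j"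
    using xc_up xc_up_other assms by auto
  define A where "A = (\<Prod>j\<in>{..<Suc N} - {i}. xc l i - xc l j)"
  define B where "B = (\<Prod>j\<in>{..<N} - {i}. xc l i - (xc l j - 1))"
  have 1: "(\<Prod>j<N. xc l i - (xc l j - 1)) = B"
    using iN by (subst prod.remove[of _ i]) (auto simp: B_def)
  have 2: "(\<Prod>j<Suc N. xc ?l i - 1 - xc ?l j) = - A"
  proof -
    have "(\<Prod>j\<in>{..<Suc N} - {i}. xc ?l i - 1 - xc ?l j) = A"
      unfolding A_def by (rule prod.cong) (use x in auto)
    then show ?thesis using iN x by (subst prod.remove[of _ i]) auto
  qed
  have 3: "(\<Prod>j\<in>{..<N} - {i}. xc ?l i - xc ?l j) = B"
    unfolding B_def by (rule prod.cong) (use x in auto)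
  have "A \<noteq> 0" unfolding A_def using xc_eq_iff[OF assms(1)] by auto
  moreover have "B \<noteq> 0"
    unfolding 3[symmetric] using xc_eq_iff[OF young_up[OF assms(1,3)]] by auto
  ultimately show ?thesis unfolding upw_def dnw_def 1 2 3 A_def[symmetric] by simp
qed

lemma dimY_up:
  assumes "young l" "length l < N" "i \<in> upI l"
  shows "real (dimY (up l i)) / (real (Suc (sum_list l)) * real (dimY l)) = upw N l i"
proof -
  note u = up_in_dnI[OF assms(1,3)]
  have "real (sum_list (up l i)) * real (dimY (dn (up l i) i)) = dnw N (up l i) i * real (dimY (up l i))"
    by (rule dimY_dn) (use u young_up[OF assms(1,3)] length_up_le[OF assms(1,3)] assms(2) in auto)
  then have "real (Suc (sum_list l)) * real (dimY l) = dnw N (up l i) i * real (dimY (up l i))"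
    using u sum_list_up[OF assms(1,3)] by simp
  moreover have "dimY (up l i) > 0" using dimY_pos young_up assms by blast
  ultimately have "real (dimY (up l i)) / (real (Suc (sum_list l)) * real (dimY l)) = 1 / dnw N (up l i) i"
    by simp
  also have "\<dots> = upw N l i"
    using upw_dnw[OF assms] by (metis mult_zero_right nonzero_eq_divide_eq zero_neq_one)
  finally show ?thesis .
qed

text \<open>The new factors of numerator and denominator agree, because consecutive empty rows have
  values \<open>xc\<close> differing by \<open>1\<close>. This lowers the strict bound of
  \<open>dimY_up\<close> to \<open>length l\<close>.\<close>

lemma upw_extend:
  assumes "young l" "length l \<le> N" "i \<in> upI l"
  shows "upw (Suc N) l i = upw N l i"
proof -
  have i: "i < Suc N" using upI_bound assms by fastforce
  have s: "{..<Suc (Suc N)} - {i} = insert (Suc N) ({..<Suc N} - {i})" using i by auto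
  have eq: "xc l i - (xc l N - 1) = xc l i - xc l (Suc N)"
    using assms by (simp add: xc_length)
  have "xc l i \<noteq> xc l (Suc N)" using xc_eq_iff[OF assms(1)] i by auto
  moreover have "(\<Prod>j<Suc N. xc l i - (xc l j - 1)) = (\<Prod>j<N. xc l i - (xc l j - 1)) * (xc l i - xc l (Suc N))"
    by (simp only: prod.lessThan_Suc eq)
  moreover have "(\<Prod>j\<in>{..<Suc (Suc N)} - {i}. xc l i - xc l j)
      = (xc l i - xc l (Suc N)) * (\<Prod>j\<in>{..<Suc N} - {i}. xc l i - xc l j)"
    unfolding s by (rule prod.insert) auto
  ultimately show ?thesis
    unfolding upw_def by (simp only:) simp
qed

section \<open>The down operator\<close>

definition Dtilde :: "(nat list \<Rightarrow> real) \<Rightarrow> nat list \<Rightarrow> real" where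
  "Dtilde f l = (if young l then
     \<Sum>i\<in>dnI l. real (sum_list l) * real (dimY (dn l i)) / real (dimY l) * f (dn l i) else 0)"

lemma Dtilde_eq:
  assumes "young l"
  shows "Dtilde f l = (\<Sum>i\<in>dnI l. dnw (length l) l i * f (dn l i))"
proof -
  have "real (sum_list l) * real (dimY (dn l i)) / real (dimY l) = dnw (length l) l i" if "i \<in> dnI l" for i
    using dimY_dn[OF assms order_refl that] dimY_pos[OF assms] by simp
  then show ?thesis using assms by (simp add: Dtilde_def)
qed

lemma Dtilde_Lam:
  assumes "f \<in> Lam"
  shows "Dtilde f \<in> Lam"
proof -
  obtain F where F: "F \<in> PL" "\<And>l i. young l \<Longrightarrow> i \<in> dnI l \<Longrightarrow> f (dn l i) = F l (xc l i - 1)"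
    using Lam_dn[OF assms] by blast
  have "Dtilde f l = (\<Sum>i<length l. dnw (length l) l i * F l (xc l i - 1))" if "young l" for l
    using Dtilde_eq[OF that] sum_dnw[OF that order_refl] F(2)[OF that] by simp
  then have "in_Lam (Dtilde f)"
    using in_Lam_PL_dn[OF F(1)] in_Lam_cong[of "Dtilde f"] by simp
  then show ?thesis by (subst (asm) in_Lam_iff) (simp_all add: Dtilde_def)
qed

lemma lin_op_Dtilde: "lin_op_Lam Dtilde"
  unfolding lin_op_Lam_def
  by (auto simp: Dtilde_Lam Dtilde_def fun_eq_iff distrib_left sum.distrib sum_distrib_left mult_ac add_divide_distrib)

lemma Dop_eq_Dtilde:
  assumes "nu \<in> Ydiag (Suc n)"
  shows "Dop n f nu = Dtilde f nu / (real n + 1)"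
proof -
  have y: "young nu" and s: "sum_list nu = Suc n" using assms by (auto simp: Ydiag_def)
  have "Dop n f nu = (\<Sum>lam\<in>{lam. lam \<nearrow> nu}. pdown nu lam * f lam)"
    unfolding Dop_def
    by (rule sum.mono_neutral_right)
       (use s finite_Ydiag[of n] in \<open>auto simp: pdown_def Ydiag_def covers_def\<close>)
  also have "\<dots> = (\<Sum>i\<in>dnI nu. real (dimY (dn nu i)) / real (dimY nu) * f (dn nu i))"
    by (simp add: sum_covers_dn[OF y] pdown_def covers_dn[OF y])
  also have "\<dots> = Dtilde f nu / (real n + 1)"
    unfolding Dtilde_def if_P[OF y] sum_divide_distrib
    by (rule sum.cong) (simp_all add: s add.commute)
  finally show ?thesis .
qed

lemma falling_0 [simp]: "falling n 0 = 1"
  by (simp add: falling_def)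

lemma falling_Suc: "falling n (Suc m) = falling n m * (real n - real m)"
  by (simp add: falling_def)

lemma falling_Suc_Suc: "falling (Suc n) (Suc m) = (real n + 1) * falling n m"
  by (simp add: falling_def prod.lessThan_Suc_shift del: prod.lessThan_Suc)

text \<open>Multiplying the falling power of \<open>n - 1\<close> by \<open>n\<close> gives that of
  \<open>n\<close> with one more factor, \<open>n - m\<close>; the remaining sum is the branching
  rule.\<close>

lemma Dtilde_FS:
  assumes "young mu"
  shows "Dtilde (FS mu) = (\<lambda>l. (psum 1 l - real (sum_list mu)) * FS mu l)"
proof
  fix l :: "nat list"
  let ?m = "sum_list mu" and ?n = "sum_list l"
  show "Dtilde (FS mu) l = (psum 1 l - real ?m) * FS mu l"
  proof (cases "young l")
    case y: True
    have pos: "dimY l > 0" using dimY_pos y by blast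
    have "Dtilde (FS mu) l = (\<Sum>i\<in>dnI l. falling ?n ?m * (real ?n - real ?m) * real (dimr mu (dn l i)) / real (dimY l))"
      unfolding Dtilde_def if_P[OF y]
    proof (rule sum.cong)
      fix i assume i: "i \<in> dnI l"
      have n: "?n = Suc (sum_list (dn l i))" using sum_list_dn[OF y i] by simp
      have "real ?n * falling (sum_list (dn l i)) ?m = falling ?n (Suc ?m)"
        unfolding n falling_Suc_Suc by simp
      then have fall: "real ?n * falling (sum_list (dn l i)) ?m = falling ?n ?m * (real ?n - real ?m)"
        by (simp only: falling_Suc)
      have "real ?n * real (dimY (dn l i)) / real (dimY l) * FS mu (dn l i)
         = (real ?n * falling (sum_list (dn l i)) ?m) * real (dimr mu (dn l i)) / real (dimY l)"
        using dimY_pos[OF young_dn[OF y i]] young_dn[OF y i] by (simp add: FS_def)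
      then show "real ?n * real (dimY (dn l i)) / real (dimY l) * FS mu (dn l i)
         = falling ?n ?m * (real ?n - real ?m) * real (dimr mu (dn l i)) / real (dimY l)"
        unfolding fall .
    qed simp
    also have "\<dots> = falling ?n ?m * ((real ?n - real ?m) * (\<Sum>i\<in>dnI l. real (dimr mu (dn l i)))) / real (dimY l)"
      by (simp add: sum_distrib_left sum_divide_distrib mult_ac)
    \<comment> \<open>For \<open>mu = l\<close> the branching rule fails, but then
      \<open>n = m\<close> and the factor is zero.\<close>
    also have "(real ?n - real ?m) * (\<Sum>i\<in>dnI l. real (dimr mu (dn l i))) = (real ?n - real ?m) * real (dimr mu l)"
      using dimr_rec[OF y, of mu] by (cases "mu = l") auto
    finally show ?thesis
      using y psum_1[OF y] by (simp add: FS_def mult_ac)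
  qed (simp add: Dtilde_def FS_def)
qed

text \<open>The intertwining relation says nothing about the value at the empty diagram; it is recovered
  because elements of the algebra are polynomial in \<open>n\<close> on the one-row diagrams \<open>[n]\<close>.\<close>
lemma Lam_one_row:
  assumes "f \<in> Lam"
  shows "\<exists>p. \<forall>n. f (if n = 0 then [] else [n]) = poly p (real n)"
  using assms
proof (induction rule: Lam.induct)
  case (const c)
  show ?case by (rule exI[of _ "[:c:]"]) (simp add: young_def)
next
  case (gen k)
  have y: "young (if n = 0 then [] else [n])" for n :: nat by (simp add: young_def)
  have "psum k (if n = 0 then [] else [n]) = poly ([:-1/2, 1:] ^ k - [:(-1/2) ^ k:]) (real n)" for n
    unfolding psum_eq_csum[OF gen y] by (simp add: csum_def xc_def row_def)
  then show ?case using y by (intro exI[of _ "[:-1/2, 1:] ^ k - [:(-1/2) ^ k:]"]) simp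
next
  case (add f g)
  then obtain p q where "\<forall>n. f (if n = 0 then [] else [n]) = poly p (real n)"
    "\<forall>n. g (if n = 0 then [] else [n]) = poly q (real n)" by blast
  then show ?case by (intro exI[of _ "p + q"]) simp
next
  case (mult f g)
  then obtain p q where "\<forall>n. f (if n = 0 then [] else [n]) = poly p (real n)"
    "\<forall>n. g (if n = 0 then [] else [n]) = poly q (real n)" by blast
  then show ?case by (intro exI[of _ "p * q"]) simp
qed

text \<open>Two polynomials that agree at all positive integers agree at \<open>0\<close>, which is
  the value at the empty diagram.\<close>

lemma Lam_eqI_nonempty:
  assumes f: "f \<in> Lam" and g: "g \<in> Lam" and eq: "\<And>l. young l \<Longrightarrow> l \<noteq> [] \<Longrightarrow> f l = g l"
  shows "f = g"
proof
  obtain p where p: "\<And>n. f (if n = 0 then [] else [n]) = poly p (real n)"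
    using Lam_one_row[OF f] by blast
  obtain q where q: "\<And>n. g (if n = 0 then [] else [n]) = poly q (real n)"
    using Lam_one_row[OF g] by blast
  have roots: "poly (p - q) (real (Suc n)) = 0" for n
    using p[of "Suc n"] q[of "Suc n"] eq[of "[Suc n]"] by (simp add: young_def)
  have "p - q = 0"
  proof (rule ccontr)
    assume "p - q \<noteq> 0"
    then have "finite {x. poly (p - q) x = 0}" by (rule poly_roots_finite)
    moreover have "range (\<lambda>n. real (Suc n)) \<subseteq> {x. poly (p - q) x = 0}" using roots by blast
    ultimately have "finite (range (\<lambda>n. real (Suc n)))" by (rule rev_finite_subset)
    then show False by (rule range_inj_infinite[THEN notE, rotated]) (auto simp: inj_def)
  qed
  then have e: "f [] = g []" using p[of 0] q[of 0] by simp
  fix l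
  show "f l = g l"
    using e eq[of l] Lam_not_young[OF f, of l] Lam_not_young[OF g, of l]
    by (cases "l = []"; cases "young l") auto
qed

section \<open>The up operator\<close>

text \<open>With \<open>a = Re (z * z')\<close> and \<open>b = Re (z + z')\<close> this is the real
  part of \<open>(z + x)(z' + x)\<close> for a real content \<open>x\<close>.\<close>

definition wt :: "real \<Rightarrow> real \<Rightarrow> real \<Rightarrow> real" where
  "wt a b x = a + b * x + x\<^sup>2"

lemma boxes_up:
  assumes "young l" "i \<in> upI l"
  shows "boxes (up l i) - boxes l = {(Suc i, Suc (row l i))}"
proof -
  have "(p, q) \<in> boxes (up l i) - boxes l \<longleftrightarrow> (p, q) = (Suc i, Suc (row l i))" for p q
    unfolding boxes_row row_up[OF assms] by (cases p) auto
  then show ?thesis by auto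
qed

lemma skew_poch_up:
  assumes "young l" "i \<in> upI l"
  shows "Re (skew_poch z (up l i) l * skew_poch z' (up l i) l) = wt (Re (z * z')) (Re (z + z')) (xc l i)"
proof -
  have *: "skew_poch u (up l i) l = u + of_real (xc l i)" for u
    unfolding skew_poch_def boxes_up[OF assms] by (simp add: xc_def)
  show ?thesis unfolding * by (simp add: wt_def algebra_simps power2_eq_square)
qed

lemma skew_poch_dn:
  assumes "young l" "i \<in> dnI l"
  shows "Re (skew_poch z l (dn l i) * skew_poch z' l (dn l i)) = wt (Re (z * z')) (Re (z + z')) (xc l i - 1)"
  using skew_poch_up[OF young_dn[OF assms], of i z z'] dn_in_upI[OF assms] xc_dn[OF assms] by simp

text \<open>The up transition with its factor \<open>zz' + n\<close> cleared, so that the weight at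
  each row is a polynomial in the content times \<open>upw\<close>.\<close>

definition Utilde :: "real \<Rightarrow> real \<Rightarrow> (nat list \<Rightarrow> real) \<Rightarrow> nat list \<Rightarrow> real" where
  "Utilde a b f l = (if young l then
     \<Sum>i\<in>upI l. wt a b (xc l i) * (real (dimY (up l i)) / (real (Suc (sum_list l)) * real (dimY l))) * f (up l i) else 0)"

lemma Utilde_eq:
  assumes "young l"
  shows "Utilde a b f l = (\<Sum>i\<in>upI l. upw (length l) l i * (wt a b (xc l i) * f (up l i)))"
proof -
  have "real (dimY (up l i)) / (real (Suc (sum_list l)) * real (dimY l)) = upw (length l) l i" if "i \<in> upI l" for i
    using dimY_up[OF assms lessI that] upw_extend[OF assms order_refl that] by simp
  then show ?thesis using assms unfolding Utilde_def if_P[OF assms]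
    by (intro sum.cong) (simp_all only: mult_ac)
qed

lemma Utilde_Lam:
  assumes "f \<in> Lam"
  shows "Utilde a b f \<in> Lam"
proof -
  obtain F where F: "F \<in> PL" "\<And>l i. young l \<Longrightarrow> i \<in> upI l \<Longrightarrow> f (up l i) = F l (xc l i)"
    using Lam_up[OF assms] by blast
  have "(\<lambda>l x. wt a b x) \<in> PL"
    using PL_poly[of "[:a, b, 1:]"] by (simp add: wt_def power2_eq_square algebra_simps)
  then have G: "(\<lambda>l x. wt a b x * F l x) \<in> PL" using F(1) PL_mult by fast
  have "Utilde a b f l = (\<Sum>i<Suc (length l). upw (length l) l i * (wt a b (xc l i) * F l (xc l i)))" if "young l" for l
    unfolding Utilde_eq[OF that] sum_upw[OF that order_refl] using F(2)[OF that] by simp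
  then have "in_Lam (Utilde a b f)"
    using in_Lam_PL_up[OF G] in_Lam_cong[of "Utilde a b f"] by simp
  then show ?thesis by (subst (asm) in_Lam_iff) (simp_all add: Utilde_def)
qed

lemma lin_op_Utilde: "lin_op_Lam (Utilde a b)"
  unfolding lin_op_Lam_def
  by (auto simp: Utilde_Lam Utilde_def fun_eq_iff distrib_left sum.distrib sum_distrib_left mult_ac add_divide_distrib)

lemma Uop_eq_Utilde:
  assumes "lam \<in> Ydiag n"
  shows "Uop z z' n f lam = Utilde (Re (z * z')) (Re (z + z')) f lam / (Re (z * z') + real n)"
proof -
  have y: "young lam" and s: "sum_list lam = n" using assms by (auto simp: Ydiag_def)
  have "Uop z z' n f lam = (\<Sum>nu\<in>{nu. lam \<nearrow> nu}. pup z z' lam nu * f nu)"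
    unfolding Uop_def
    by (rule sum.mono_neutral_right)
       (use s finite_Ydiag[of "Suc n"] in \<open>auto simp: pup_def Ydiag_def covers_def\<close>)
  also have "\<dots> = (\<Sum>i\<in>upI lam. pup z z' lam (up lam i) * f (up lam i))"
    by (rule sum_covers_up[OF y])
  also have "\<dots> = Utilde (Re (z * z')) (Re (z + z')) f lam / (Re (z * z') + real n)"
    unfolding Utilde_def if_P[OF y] sum_divide_distrib
    by (rule sum.cong) (simp_all add: pup_def covers_up[OF y] skew_poch_up[OF y] s add.commute del: times_complex.sel plus_complex.sel)
  finally show ?thesis .
qed

section \<open>Exchanging the addition and the removal of a box\<close>

text \<open>Row \<open>i + 1\<close> is addable exactly if row \<open>i\<close> is removable.
  Otherwise both rows have equal length and their terms cancel in the sum over all rows.\<close>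

lemma sum_upI_minus_dnI:
  assumes "young l"
  shows "(\<Sum>i\<in>upI l. \<phi> (xc l i)) - (\<Sum>i\<in>dnI l. \<phi> (xc l i - 1)) = \<phi> 0 + csum (\<lambda>x. \<phi> x - \<phi> (x - 1)) l"
proof -
  let ?N = "length l"
  have iff: "Suc i \<in> upI l \<longleftrightarrow> i \<in> dnI l" for i by (simp add: upI_def dnI_def)
  have 0: "0 \<in> upI l" by (simp add: upI_def)
  have img: "{..<Suc ?N} - upI l = Suc ` ({..<?N} - dnI l)"
  proof (intro equalityI subsetI)
    fix x assume x: "x \<in> {..<Suc ?N} - upI l"
    with 0 obtain i where "x = Suc i" by (cases x) auto
    with x show "x \<in> Suc ` ({..<?N} - dnI l)" using iff by auto
  qed (use iff in auto)
  have "(\<Sum>i\<in>{..<Suc ?N} - upI l. \<phi> (xc l i)) = (\<Sum>i\<in>{..<?N} - dnI l. \<phi> (xc l (Suc i)))"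
    unfolding img by (subst sum.reindex) auto
  also have "\<dots> = (\<Sum>i\<in>{..<?N} - dnI l. \<phi> (xc l i - 1))"
  proof (rule sum.cong)
    fix i assume "i \<in> {..<?N} - dnI l"
    then have "row l (Suc i) = row l i"
      using row_mono[OF assms, of i "Suc i"] by (auto simp: dnI_def)
    then have "xc l (Suc i) = xc l i - 1" by (simp add: xc_def)
    then show "\<phi> (xc l (Suc i)) = \<phi> (xc l i - 1)" by simp
  qed simp
  finally have c: "(\<Sum>i\<in>{..<Suc ?N} - upI l. \<phi> (xc l i)) = (\<Sum>i\<in>{..<?N} - dnI l. \<phi> (xc l i - 1))" .
  have U: "(\<Sum>i<Suc ?N. \<phi> (xc l i)) = (\<Sum>i\<in>{..<Suc ?N} - upI l. \<phi> (xc l i)) + (\<Sum>i\<in>upI l. \<phi> (xc l i))"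
    by (rule sum.subset_diff) (auto dest: upI_bound)
  have D: "(\<Sum>i<?N. \<phi> (xc l i - 1)) = (\<Sum>i\<in>{..<?N} - dnI l. \<phi> (xc l i - 1)) + (\<Sum>i\<in>dnI l. \<phi> (xc l i - 1))"
    by (rule sum.subset_diff) (auto dest: dnI_bound)
  show ?thesis using sum_xc_interlacing[OF order_refl, of \<phi> l] c unfolding U D by simp
qed

text \<open>The commutator of weighted addition and removal: constants have \<open>csum\<close>
  zero, so only the slope \<open>2\<close> of the first difference of \<open>wt\<close> and its
  value \<open>a\<close> at \<open>0\<close> survive.\<close>

lemma sum_wt:
  assumes "young l"
  shows "(\<Sum>i\<in>upI l. wt a b (xc l i)) - (\<Sum>i\<in>dnI l. wt a b (xc l i - 1)) = a + 2 * real (sum_list l)"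
proof -
  have "(\<Sum>i\<in>upI l. wt a b (xc l i)) - (\<Sum>i\<in>dnI l. wt a b (xc l i - 1))
      = a + csum (\<lambda>x. 2 * x + (b - 1)) l"
    unfolding sum_upI_minus_dnI[OF assms] by (simp add: wt_def power2_eq_square algebra_simps)
  also have "csum (\<lambda>x. 2 * x + (b - 1)) l = 2 * real (sum_list l)"
    by (simp add: csum_def xc_def sum_list_row[of l "length l"] sum_distrib_left)
  finally show ?thesis .
qed

text \<open>The two moves interact only for \<open>i = Suc k\<close>, where both sides say that row
  \<open>k\<close> is at least two boxes longer than row \<open>i\<close>.\<close>

lemma exchange_iff:
  assumes "young l" "i \<noteq> k"
  shows "i \<in> upI l \<and> k \<in> dnI (up l i) \<longleftrightarrow> k \<in> dnI l \<and> i \<in> upI (dn l k)"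
proof
  assume a: "i \<in> upI l \<and> k \<in> dnI (up l i)"
  then have k: "k \<in> dnI l" using assms by (auto simp: dnI_def row_up split: if_splits)
  moreover have "i \<in> upI (dn l k)"
  proof (cases "i = Suc k")
    case True
    then have "Suc (row l i) < row l k" using a assms by (auto simp: dnI_def row_up)
    then show ?thesis using True by (auto simp: upI_def row_dn[OF assms(1) k])
  next
    case False
    then show ?thesis using a assms by (auto simp: upI_def row_dn[OF assms(1) k])
  qed
  ultimately show "k \<in> dnI l \<and> i \<in> upI (dn l k)" by blast
next
  assume a: "k \<in> dnI l \<and> i \<in> upI (dn l k)"
  then have i: "i \<in> upI l" using assms by (auto simp: upI_def row_dn split: if_splits)
  moreover have "k \<in> dnI (up l i)"
  proof (cases "i = Suc k")
    case True
    then have "row l i < row l k - 1" using a assms by (auto simp: upI_def row_dn)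
    then show ?thesis using True i by (auto simp: dnI_def row_up[OF assms(1)])
  next
    case False
    then show ?thesis using a assms by (auto simp: dnI_def row_up[OF assms(1) i])
  qed
  ultimately show "i \<in> upI l \<and> k \<in> dnI (up l i)" by blast
qed

lemma exchange_eq:
  assumes "young l" "i \<noteq> k" "i \<in> upI l" "k \<in> dnI (up l i)"
  shows "dn (up l i) k = up (dn l k) i"
proof -
  have k: "k \<in> dnI l" "i \<in> upI (dn l k)" using exchange_iff assms by blast+
  note y = young_up[OF assms(1,3)] young_dn[OF assms(1) k(1)]
  show ?thesis
  proof (rule row_inject)
    show "row (dn (up l i) k) = row (up (dn l k) i)"
      using assms(2) by (auto simp: row_dn[OF y(1) assms(4)] row_up[OF y(2) k(2)] row_up[OF assms(1,3)]
          row_dn[OF assms(1) k(1)])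
  qed (use young_dn[OF y(1) assms(4)] young_up[OF y(2) k(2)] in auto)
qed

text \<open>Induction on the size of \<open>l\<close>: removing a box other than the one just added commutes with the
  addition; the remaining terms are collected by the balance \<open>sum_wt\<close>.\<close>
lemma sum_wt_dimr_up:
  assumes "young mu" "young l"
  shows "(\<Sum>i\<in>upI l. wt a b (xc l i) * real (dimr mu (up l i)))
    = (\<Sum>j\<in>dnI mu. wt a b (xc mu j - 1) * real (dimr (dn mu j) l))
      + (real (sum_list l) - real (sum_list mu) + 1) * (a + real (sum_list l) + real (sum_list mu)) * real (dimr mu l)"
  using assms(2)
proof (induction "sum_list l" arbitrary: l rule: less_induct)
  case less
  note y = less.prems
  let ?n = "sum_list l" and ?m = "sum_list mu"
  consider "?n + 1 < ?m" | "?m = ?n + 1" | "?m \<le> ?n" by linarith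
  then show ?case
  proof cases
    case 1
    have "dimr mu (up l i) = 0" if "i \<in> upI l" for i
      using 1 sum_list_up[OF y that] by (intro dimr_eq_0) auto
    moreover have "dimr (dn mu j) l = 0" if "j \<in> dnI mu" for j
      using 1 sum_list_dn[OF assms(1) that] by (intro dimr_eq_0) linarith
    moreover have "dimr mu l = 0" using 1 by (intro dimr_eq_0) auto
    ultimately show ?thesis by simp
  next
    case 2
    have L: "dimr mu (up l i) = (if mu = up l i then 1 else 0)" if "i \<in> upI l" for i
      using 2 sum_list_up[OF y that] dimr_eq_0[of "up l i" mu] dimr_self[OF assms(1)] by auto
    have R: "dimr (dn mu j) l = (if dn mu j = l then 1 else 0)" if "j \<in> dnI mu" for j
      using 2 sum_list_dn[OF assms(1) that] dimr_eq_0[of l "dn mu j"] dimr_self[OF y] by auto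
    have "dimr mu l = 0" using 2 by (intro dimr_eq_0) auto
    moreover have "(\<Sum>i\<in>upI l. wt a b (xc l i) * real (dimr mu (up l i)))
      = (\<Sum>j\<in>dnI mu. wt a b (xc mu j - 1) * real (dimr (dn mu j) l))"
    \<comment> \<open>Each sum has at most one nonzero term, present exactly if \<open>mu\<close>
      covers \<open>l\<close>; it sits at the same row and content on both sides.\<close>
    proof (cases "\<exists>k\<in>upI l. mu = up l k")
      case True
      then obtain k where k: "k \<in> upI l" "mu = up l k" by blast
      have k': "k \<in> dnI mu" "dn mu k = l" using up_in_dnI[OF y k(1)] k(2) by auto
      have "(\<Sum>i\<in>upI l. wt a b (xc l i) * real (dimr mu (up l i))) = (\<Sum>i\<in>upI l. if i = k then wt a b (xc l i) else 0)"
        by (rule sum.cong) (use L k inj_up[OF y] in \<open>auto simp: inj_on_def\<close>)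
      moreover have "(\<Sum>j\<in>dnI mu. wt a b (xc mu j - 1) * real (dimr (dn mu j) l))
          = (\<Sum>j\<in>dnI mu. if j = k then wt a b (xc mu j - 1) else 0)"
        by (rule sum.cong) (use R k' inj_dn[OF assms(1)] in \<open>auto simp: inj_on_def\<close>)
      moreover have "xc mu k - 1 = xc l k" using xc_up[OF y k(1)] k(2) by simp
      ultimately show ?thesis using k k' by simp
    next
      case False
      have "dn mu j \<noteq> l" if "j \<in> dnI mu" for j
        using dn_in_upI[OF assms(1) that] False by auto
      then show ?thesis using L R False by simp
    qed
    ultimately show ?thesis by simp
  next
    case 3
    let ?d = "\<lambda>nu. real (dimr mu nu)"
    \<comment> \<open>Taking away the box just added returns \<open>l\<close>; this term is split
      off, since it has no counterpart in the other order.\<close>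
    have rec: "?d (up l i) = ?d l + (\<Sum>k\<in>dnI (up l i) - {i}. ?d (dn (up l i) k))" if i: "i \<in> upI l" for i
    proof -
      have "mu \<noteq> up l i" using 3 sum_list_up[OF y i] by auto
      then have "?d (up l i) = (\<Sum>k\<in>dnI (up l i). ?d (dn (up l i) k))"
        using dimr_rec[OF young_up[OF y i]] by simp
      then show ?thesis using up_in_dnI[OF y i] by (simp add: sum.remove[of _ i])
    qed
    have "(\<Sum>i\<in>upI l. wt a b (xc l i) * ?d (up l i))
        = ?d l * (\<Sum>i\<in>upI l. wt a b (xc l i))
          + (\<Sum>i\<in>upI l. \<Sum>k\<in>dnI (up l i) - {i}. wt a b (xc l i) * ?d (dn (up l i) k))"
      by (simp add: rec distrib_left sum.distrib sum_distrib_left mult_ac)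
    also have "(\<Sum>i\<in>upI l. \<Sum>k\<in>dnI (up l i) - {i}. wt a b (xc l i) * ?d (dn (up l i) k))
        = (\<Sum>k\<in>dnI l. \<Sum>i\<in>upI (dn l k) - {k}. wt a b (xc (dn l k) i) * ?d (up (dn l k) i))"
    proof -
      have "(\<Sum>i\<in>upI l. \<Sum>k\<in>dnI (up l i) - {i}. wt a b (xc l i) * ?d (dn (up l i) k))
          = (\<Sum>(i, k)\<in>Sigma (upI l) (\<lambda>i. dnI (up l i) - {i}). wt a b (xc l i) * ?d (dn (up l i) k))"
        by (rule sum.Sigma) auto
      also have "\<dots> = (\<Sum>(k, i)\<in>Sigma (dnI l) (\<lambda>k. upI (dn l k) - {k}). wt a b (xc (dn l k) i) * ?d (up (dn l k) i))"
      proof (rule sum.reindex_bij_witness[of _ prod.swap prod.swap])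
        fix p assume p: "p \<in> Sigma (upI l) (\<lambda>i. dnI (up l i) - {i})"
        obtain i k where ik: "p = (i, k)" by force
        have *: "i \<in> upI l" "k \<in> dnI (up l i)" "i \<noteq> k" using p ik by auto
        have **: "k \<in> dnI l" "i \<in> upI (dn l k)" using exchange_iff[OF y *(3)] * by blast+
        show "prod.swap p \<in> Sigma (dnI l) (\<lambda>k. upI (dn l k) - {k})" using ** * ik by auto
        show "(case prod.swap p of (k, i) \<Rightarrow> wt a b (xc (dn l k) i) * ?d (up (dn l k) i))
            = (case p of (i, k) \<Rightarrow> wt a b (xc l i) * ?d (dn (up l i) k))"
          using exchange_eq[OF y *(3,1,2)] xc_dn_other[OF y **(1) *(3)] ik by simp
      next
        fix p assume p: "p \<in> Sigma (dnI l) (\<lambda>k. upI (dn l k) - {k})"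
        obtain k i where ik: "p = (k, i)" by force
        have *: "k \<in> dnI l" "i \<in> upI (dn l k)" "i \<noteq> k" using p ik by auto
        then show "prod.swap p \<in> Sigma (upI l) (\<lambda>i. dnI (up l i) - {i})"
          using exchange_iff[OF y *(3)] ik by auto
      qed auto
      also have "\<dots> = (\<Sum>k\<in>dnI l. \<Sum>i\<in>upI (dn l k) - {k}. wt a b (xc (dn l k) i) * ?d (up (dn l k) i))"
        by (rule sum.Sigma[symmetric]) auto
      finally show ?thesis .
    qed
    also have "\<dots> = (\<Sum>k\<in>dnI l. (\<Sum>j\<in>dnI mu. wt a b (xc mu j - 1) * real (dimr (dn mu j) (dn l k)))
        + (real ?n - real ?m) * (a + real ?n + real ?m - 1) * ?d (dn l k) - wt a b (xc l k - 1) * ?d l)"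
    proof (rule sum.cong)
      fix k assume k: "k \<in> dnI l"
      note u = dn_in_upI[OF y k]
      have n: "real (sum_list (dn l k)) = real ?n - 1" using sum_list_dn[OF y k] by simp
      have "(\<Sum>i\<in>upI (dn l k) - {k}. wt a b (xc (dn l k) i) * ?d (up (dn l k) i))
          = (\<Sum>i\<in>upI (dn l k). wt a b (xc (dn l k) i) * ?d (up (dn l k) i)) - wt a b (xc l k - 1) * ?d l"
        using u xc_dn[OF y k] by (simp add: sum.remove[of _ k])
      also have "(\<Sum>i\<in>upI (dn l k). wt a b (xc (dn l k) i) * ?d (up (dn l k) i))
          = (\<Sum>j\<in>dnI mu. wt a b (xc mu j - 1) * real (dimr (dn mu j) (dn l k)))
        + (real ?n - real ?m) * (a + real ?n + real ?m - 1) * ?d (dn l k)"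
        \<comment> \<open>For \<open>n - 1\<close> in place of \<open>n\<close> the coefficient is
          \<open>(n - m) * (a + n + m - 1)\<close>.\<close>
        using less.hyps[OF _ young_dn[OF y k]] sum_list_dn[OF y k] unfolding n by (simp add: algebra_simps)
      finally show "(\<Sum>i\<in>upI (dn l k) - {k}. wt a b (xc (dn l k) i) * ?d (up (dn l k) i))
        = (\<Sum>j\<in>dnI mu. wt a b (xc mu j - 1) * real (dimr (dn mu j) (dn l k)))
        + (real ?n - real ?m) * (a + real ?n + real ?m - 1) * ?d (dn l k) - wt a b (xc l k - 1) * ?d l" .
    qed simp
    also have "\<dots> = (\<Sum>k\<in>dnI l. \<Sum>j\<in>dnI mu. wt a b (xc mu j - 1) * real (dimr (dn mu j) (dn l k)))
        + (real ?n - real ?m) * (a + real ?n + real ?m - 1) * (\<Sum>k\<in>dnI l. ?d (dn l k))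
        - (\<Sum>k\<in>dnI l. wt a b (xc l k - 1)) * ?d l"
      by (simp add: sum.distrib sum_subtractf sum_distrib_left sum_distrib_right)
    also have "(\<Sum>k\<in>dnI l. \<Sum>j\<in>dnI mu. wt a b (xc mu j - 1) * real (dimr (dn mu j) (dn l k)))
        = (\<Sum>j\<in>dnI mu. wt a b (xc mu j - 1) * real (dimr (dn mu j) l))"
    proof (subst sum.swap, rule sum.cong)
      fix j assume j: "j \<in> dnI mu"
      have "dn mu j \<noteq> l" using 3 sum_list_dn[OF assms(1) j] by auto
      then show "(\<Sum>k\<in>dnI l. wt a b (xc mu j - 1) * real (dimr (dn mu j) (dn l k)))
          = wt a b (xc mu j - 1) * real (dimr (dn mu j) l)"
        using dimr_rec[OF y] by (simp add: sum_distrib_left)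
    qed simp
    also have "(real ?n - real ?m) * (a + real ?n + real ?m - 1) * (\<Sum>k\<in>dnI l. ?d (dn l k))
        = (real ?n - real ?m) * (a + real ?n + real ?m - 1) * ?d l"
      \<comment> \<open>For \<open>mu = l\<close> both sides vanish with
        \<open>n - m\<close>.\<close>
      using dimr_rec[OF y, of mu] by (cases "mu = l") auto
    finally have "(\<Sum>i\<in>upI l. wt a b (xc l i) * ?d (up l i))
        = (\<Sum>j\<in>dnI mu. wt a b (xc mu j - 1) * real (dimr (dn mu j) l))
          + (real ?n - real ?m) * (a + real ?n + real ?m - 1) * ?d l
          + ((\<Sum>i\<in>upI l. wt a b (xc l i)) - (\<Sum>k\<in>dnI l. wt a b (xc l k - 1))) * ?d l"
      by (simp add: algebra_simps)
    \<comment> \<open>The constants combine by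
      \<open>(n - m)(a + n + m - 1) + (a + 2n) = (n - m + 1)(a + n + m)\<close>.\<close>
    then show ?thesis unfolding sum_wt[OF y] by (simp add: algebra_simps)
  qed
qed

lemma Utilde_FS:
  assumes mu: "young mu" and a: "a = Re (z * z')" and b: "b = Re (z + z')"
  shows "Utilde a b (FS mu) = (\<lambda>l. (\<Sum>mb\<in>{mb. mb \<nearrow> mu}.
      Re (skew_poch z mu mb * skew_poch z' mu mb) * FS mb l) + (psum 1 l + a + real (sum_list mu)) * FS mu l)"
proof
  fix l :: "nat list"
  let ?m = "sum_list mu" and ?n = "sum_list l"
  show "Utilde a b (FS mu) l = (\<Sum>mb\<in>{mb. mb \<nearrow> mu}.
      Re (skew_poch z mu mb * skew_poch z' mu mb) * FS mb l) + (psum 1 l + a + real ?m) * FS mu l"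
  proof (cases "young l")
    case False
    then show ?thesis by (simp add: Utilde_def FS_def)
  next
    case y: True
    \<comment> \<open>For \<open>m \<ge> 1\<close> this is the falling power of \<open>n\<close>
      with \<open>m - 1\<close> factors, as required for the diagrams below \<open>mu\<close>. For
      empty \<open>mu\<close> there are none, and \<open>self\<close> still holds.\<close>
    define c where "c = falling (Suc ?n) ?m / real (Suc ?n)"
    have down: "c = falling ?n (sum_list (dn mu j))" if "j \<in> dnI mu" for j
      unfolding c_def sum_list_dn[OF mu that, symmetric] falling_Suc_Suc by (simp add: add.commute)
    have self: "c * (real ?n - real ?m + 1) = falling ?n ?m"
    proof -
      have "falling (Suc ?n) ?m * (real (Suc ?n) - real ?m) = real (Suc ?n) * falling ?n ?m"
        using falling_Suc[of "Suc ?n" ?m] falling_Suc_Suc[of ?n ?m] by (simp add: add.commute)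
      then show ?thesis by (simp add: c_def field_simps)
    qed
    have "Utilde a b (FS mu) l = (\<Sum>i\<in>upI l. c / real (dimY l) * (wt a b (xc l i) * real (dimr mu (up l i))))"
      unfolding Utilde_def if_P[OF y]
    proof (rule sum.cong)
      fix i assume i: "i \<in> upI l"
      show "wt a b (xc l i) * (real (dimY (up l i)) / (real (Suc ?n) * real (dimY l))) * FS mu (up l i)
         = c / real (dimY l) * (wt a b (xc l i) * real (dimr mu (up l i)))"
        using dimY_pos[OF young_up[OF y i]] young_up[OF y i] sum_list_up[OF y i]
        by (simp add: FS_def c_def)
    qed simp
    also have "\<dots> = c / real (dimY l) * (\<Sum>j\<in>dnI mu. wt a b (xc mu j - 1) * real (dimr (dn mu j) l))
        + (c * (real ?n - real ?m + 1)) * (a + real ?n + real ?m) * real (dimr mu l) / real (dimY l)"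
      unfolding sum_distrib_left[symmetric] sum_wt_dimr_up[OF mu y] by (simp add: distrib_left mult_ac add_divide_distrib)
    also have "c / real (dimY l) * (\<Sum>j\<in>dnI mu. wt a b (xc mu j - 1) * real (dimr (dn mu j) l))
        = (\<Sum>j\<in>dnI mu. wt a b (xc mu j - 1) * FS (dn mu j) l)"
      unfolding sum_distrib_left by (rule sum.cong) (use down y in \<open>auto simp: FS_def\<close>)
    also have "\<dots> = (\<Sum>mb\<in>{mb. mb \<nearrow> mu}. Re (skew_poch z mu mb * skew_poch z' mu mb) * FS mb l)"
      unfolding sum_covers_dn[OF mu] by (rule sum.cong) (simp_all only: skew_poch_dn[OF mu] a b)
    finally show ?thesis
      unfolding self psum_1[OF y] using y by (simp add: FS_def mult_ac add_ac)
  qed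
qed

section \<open>Positivity of the parameter product and uniqueness of the operators\<close>

text \<open>Keeps \<open>zz' + n\<close> nonzero also for \<open>n = 0\<close>, so the up relation
  determines the operator at the empty diagram as well.\<close>

lemma admissible_pos: "admissible z z' \<Longrightarrow> 0 < Re (z * z')"
proof -
  assume "admissible z z'"
  then consider "Im z \<noteq> 0" "z' = cnj z"
    | N :: int where "Im z = 0" "Im z' = 0" "of_int N < Re z" "Re z < of_int N + 1"
        "of_int N < Re z'" "Re z' < of_int N + 1"
    unfolding admissible_def by blast
  then show ?thesis
  proof cases
    case 1
    then have "0 < Re z * Re z + Im z * Im z"
      by (intro add_nonneg_pos) (auto simp: zero_less_mult_iff)
    then show ?thesis using 1 by simp
  next
    case 2
    show ?thesis
    proof (cases "N \<ge> 0")
      case True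
      then have "(0::real) \<le> of_int N" by simp
      then have "0 < Re z" "0 < Re z'" using 2 by linarith+
      then show ?thesis using 2 by simp
    next
      case False
      then have "real_of_int N + 1 \<le> 0" by linarith
      then have "Re z < 0" "Re z' < 0" using 2 by linarith+
      then show ?thesis using 2 by (simp add: mult_neg_neg)
    qed
  qed
qed

lemma Ydiag_cases: "young l \<Longrightarrow> l \<noteq> [] \<Longrightarrow> \<exists>n. l \<in> Ydiag (Suc n)"
  by (cases "sum_list l") (auto simp: Ydiag_def young_def neq_Nil_conv)

theorem theorem4p1:
  fixes z z' :: complex
  assumes "admissible z z'"
  shows
   "(\<exists>Dt. lin_op_Lam Dt \<and>
        (\<forall>n. \<forall>f\<in>Lam. \<forall>nu\<in>Ydiag (Suc n). Dop n f nu = Dt f nu / (real n + 1)) \<and>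
        (\<forall>D'. lin_op_Lam D' \<and>
            (\<forall>n. \<forall>f\<in>Lam. \<forall>nu\<in>Ydiag (Suc n). Dop n f nu = D' f nu / (real n + 1))
            \<longrightarrow> (\<forall>f\<in>Lam. D' f = Dt f)) \<and>
        (\<forall>mu. young mu \<longrightarrow>
            Dt (FS mu) = (\<lambda>l. (psum 1 l - real (sum_list mu)) * FS mu l)))
    \<and>
    (\<exists>Ut. lin_op_Lam Ut \<and>
        (\<forall>n. \<forall>f\<in>Lam. \<forall>lam\<in>Ydiag n.
            Uop z z' n f lam = Ut f lam / (Re (z * z') + real n)) \<and>
        (\<forall>U'. lin_op_Lam U' \<and>
            (\<forall>n. \<forall>f\<in>Lam. \<forall>lam\<in>Ydiag n.
               Uop z z' n f lam = U' f lam / (Re (z * z') + real n))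
            \<longrightarrow> (\<forall>f\<in>Lam. U' f = Ut f)) \<and>
        (\<forall>mu. young mu \<longrightarrow>
            Ut (FS mu) = (\<lambda>l. (\<Sum>mb\<in>{mb. mb \<nearrow> mu}.
                  Re (skew_poch z mu mb * skew_poch z' mu mb) * FS mb l)
              + (psum 1 l + Re (z * z') + real (sum_list mu)) * FS mu l)))"
proof (intro conjI exI)
  show "lin_op_Lam Dtilde" by (rule lin_op_Dtilde)
  show "\<forall>n. \<forall>f\<in>Lam. \<forall>nu\<in>Ydiag (Suc n). Dop n f nu = Dtilde f nu / (real n + 1)"
    using Dop_eq_Dtilde by blast
  show "\<forall>D'. lin_op_Lam D' \<and>
            (\<forall>n. \<forall>f\<in>Lam. \<forall>nu\<in>Ydiag (Suc n). Dop n f nu = D' f nu / (real n + 1))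
            \<longrightarrow> (\<forall>f\<in>Lam. D' f = Dtilde f)"
  proof (intro allI impI ballI)
    fix D' f
    assume D': "lin_op_Lam D' \<and>
            (\<forall>n. \<forall>f\<in>Lam. \<forall>nu\<in>Ydiag (Suc n). Dop n f nu = D' f nu / (real n + 1))" and f: "f \<in> Lam"
    show "D' f = Dtilde f"
    \<comment> \<open>The down relation reaches diagrams of size \<open>n + 1\<close> only; the
      value at the empty one follows from membership in \<open>Lam\<close>.\<close>
    proof (rule Lam_eqI_nonempty)
      show "D' f \<in> Lam" using D' f by (simp add: lin_op_Lam_def)
      show "Dtilde f \<in> Lam" using f by (rule Dtilde_Lam)
      fix l assume "young l" "l \<noteq> []"
      then obtain n where n: "l \<in> Ydiag (Suc n)" using Ydiag_cases by blast
      then have "D' f l / (real n + 1) = Dtilde f l / (real n + 1)"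
        using D' f Dop_eq_Dtilde[OF n, of f] by metis
      then show "D' f l = Dtilde f l" by simp
    qed
  qed
  show "\<forall>mu. young mu \<longrightarrow> Dtilde (FS mu) = (\<lambda>l. (psum 1 l - real (sum_list mu)) * FS mu l)"
    using Dtilde_FS by blast
  let ?U = "Utilde (Re (z * z')) (Re (z + z'))"
  show "lin_op_Lam ?U" by (rule lin_op_Utilde)
  show "\<forall>n. \<forall>f\<in>Lam. \<forall>lam\<in>Ydiag n. Uop z z' n f lam = ?U f lam / (Re (z * z') + real n)"
    using Uop_eq_Utilde by blast
  show "\<forall>U'. lin_op_Lam U' \<and>
            (\<forall>n. \<forall>f\<in>Lam. \<forall>lam\<in>Ydiag n. Uop z z' n f lam = U' f lam / (Re (z * z') + real n))
            \<longrightarrow> (\<forall>f\<in>Lam. U' f = ?U f)"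
  proof (intro allI impI ballI ext)
    fix U' f l
    assume U': "lin_op_Lam U' \<and>
            (\<forall>n. \<forall>f\<in>Lam. \<forall>lam\<in>Ydiag n. Uop z z' n f lam = U' f lam / (Re (z * z') + real n))" and f: "f \<in> Lam"
    show "U' f l = ?U f l"
    proof (cases "young l")
      case True
      then have l: "l \<in> Ydiag (sum_list l)" by (simp add: Ydiag_def)
      have "U' f l / (Re (z * z') + real (sum_list l)) = ?U f l / (Re (z * z') + real (sum_list l))"
        using U' f l Uop_eq_Utilde[OF l, of z z' f] by metis
      moreover have "Re (z * z') + real (sum_list l) \<noteq> 0"
        using admissible_pos[OF assms] by linarith
      ultimately show ?thesis by simp
    next
      case False
      have "U' f \<in> Lam" using U' f by (simp add: lin_op_Lam_def)
      then show ?thesis using Lam_not_young False by (simp add: Utilde_def)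
    qed
  qed
  show "\<forall>mu. young mu \<longrightarrow> ?U (FS mu) = (\<lambda>l. (\<Sum>mb\<in>{mb. mb \<nearrow> mu}.
                  Re (skew_poch z mu mb * skew_poch z' mu mb) * FS mb l)
              + (psum 1 l + Re (z * z') + real (sum_list mu)) * FS mu l)"
    using Utilde_FS by blast
qed

end
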